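(* The generating functions $L^k$, $L^k_j$, $D^k_i$ satisfy: $L^0(\boldsymbol{x})=1$, $L^1(\boldsymbol{x})=\dfrac{x_1}{(1-x_1)^2}$, and for $k\ge2$, \begin{align*} L^k(\boldsymbol{x}) = & \, \frac{1}{1-x_1}\bigg[x_1^2L^k_1(\boldsymbol{x}) + (x_1+x_1^2)L^{k-1}(\boldsymbol{x};\hat{x}_1) \\ & +\sum_{i=2}^k x_1x_i \big[2L^{k-1}(\boldsymbol{x}; \hat{x}_1)+L^{k-1}_{i-1}(\boldsymbol{x}; \hat{x}_i) + L^{k-2}(\boldsymbol{x}; \hat{x}_1, \hat{x}_i) + L_i^k(\boldsymbol{x}) +L_{i-1}^k(\boldsymbol{x})\big] \bigg]; \end{align*} for $k\ge1$, $L^k_k(\boldsymbol{x})=D^k_k(\boldsymbol{x})$, and for $1\le j<k$, \begin{align*} L_j^k(\boldsymbol{x}) = & \, \frac{1}{1-x_1x_{j+1}}\bigg[D_j^k(\boldsymbol{x}) + \sum_{i=j+2}^k x_1x_{i} L_{i-1}^k(\boldsymbol{x}) \\ & + \sum_{i=j+1}^kx_1x_i\big[2L^{k-1}(\boldsymbol{x}; \hat{x}_1) + L_{i-1}^{k-1}(\boldsymbol{x}; \hat{x}_i)+L^{k-2}(\boldsymbol{x}; \hat{x}_1, \hat{x}_i) + L_i^k(\boldsymbol{x})\big] \bigg]; \end{align*} for $k\ge1$, $D^k_1(\boldsymbol{x})=\dfrac{x_1}{1-x_1}L^{k-1}(\boldsymbol{x};\hat x_1)$, and for $2\le i\le k$,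 \[ D_i^k(\boldsymbol{x}) = \frac{1}{1-x_1x_i}\bigg[D_{i-1}^k(\boldsymbol{x}) +x_1x_i\big[D_{i-1}^k(\boldsymbol{x}) +D_{i-1}^{k-1}(\boldsymbol{x}; \hat{x}_i)+L^{k-2}(\boldsymbol{x}; \hat{x}_1, \hat{x}_i) + 2L^{k-1}(\boldsymbol{x}; \hat{x}_1)\big]\bigg]. \]
   Context: $\mathcal{S}_n$ is the set of permutations of $[n]$, in one-line notation $\pi=\pi_1\cdots\pi_n$. A sequence is unimodal if it is strictly increasing and then strictly decreasing. For a composition $\lambda=(\lambda_1,\ldots,\lambda_k)$ of $n$ (positive integers summing to $n$), $\pi\in\mathcal{S}_n$ is $\lambda$-unimodal if cutting its one-line notation into consecutive segments of lengths $\lambda_1,\ldots,\lambda_k$ gives unimodal segments. An involution is a permutation equal to its own inverse. $\mathcal{I}^\lambda$ is the set of $\lambda$-unimodal involutions. Let $s^i_\lambda=\lambda_1+\cdots+\lambda_i$. For $1\le j\le k$, $\mathcal{I}^\lambda_j$ is the set of $\pi\in\mathcal{I}^\lambda$ such that either ($\pi_1\le s^j_\lambda$ and $\pi_1>\pi_2>\cdots>\pi_{\lambda_1}$) or $\pi_1>s^j_\lambda$. For $1\le i\le k$, $\mathcal{D}^\lambda_i$ is the set of $\pi\in\mathcal{I}^\lambda$ with $\pi_1\le s^i_\lambda$ and $\pi_1>\pi_2>\cdots>\pi_{\lambda_1}$. $\Lambda_k$ is the set of compositions (of any positive integer) with exactly $k$ parts; $\boldsymbol{x}=(x_1,\ldots,x_k)$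 are indeterminates and $x^\lambda=x_1^{\lambda_1}\cdots x_k^{\lambda_k}$. Define the formal power series $L^k(\boldsymbol{x})=\sum_{\lambda\in\Lambda_k}|\mathcal{I}^\lambda|x^\lambda$, $L^k_j(\boldsymbol{x})=\sum_{\lambda\in\Lambda_k}|\mathcal{I}^\lambda_j|x^\lambda$, $D^k_i(\boldsymbol{x})=\sum_{\lambda\in\Lambda_k}|\mathcal{D}^\lambda_i|x^\lambda$, with $L^0=1$. Notation: for one of these series $F$ in $m=k-r$ variables, $F(\boldsymbol{x};\hat x_{i_1},\ldots,\hat x_{i_r})$ denotes $F$ evaluated at the variables $x_1,\ldots,x_k$ with $x_{i_1},\ldots,x_{i_r}$ deleted, taken in increasing order of index (the $a$-th variable of $F$ is replaced by the $a$-th remaining variable). *)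

theory Defs
  imports Complex_Main "HOL-Library.Poly_Mapping" "HOL-Combinatorics.Permutations"
begin

section \<open>Multivariate formal power series\<close>

text \<open>
  Formal power series over \<open>'a\<close> in variables indexed by \<open>nat\<close>; monomials are finitely supported
  exponent vectors \<open>nat \<Rightarrow>\<^sub>0 nat\<close>.  A series in \<open>x\<^sub>1, \<dots>, x\<^sub>k\<close> is one all of whose monomials are
  supported in \<open>{1..k}\<close>, so that all numbers of variables live in a single ring.
\<close>

typedef 'a mps = "UNIV :: ((nat \<Rightarrow>\<^sub>0 nat) \<Rightarrow> 'a) set"
  morphisms mps_coeff Abs_mps ..

setup_lifting type_definition_mps

lemma mps_eqI: "(\<And>m. mps_coeff f m = mps_coeff g m) \<Longrightarrow> f = g"
  by transfer auto

lemma finite_splits: "finite {(a, b). a + b = (m :: nat \<Rightarrow>\<^sub>0 nat)}"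
proof -
  let ?T = "PiE (Poly_Mapping.keys m) (\<lambda>i. {..Poly_Mapping.lookup m i})"
  have *: "Poly_Mapping.lookup a i = 0" if "a + b = m" "i \<notin> Poly_Mapping.keys m" for a b :: "nat \<Rightarrow>\<^sub>0 nat" and i
    using that by (metis add_eq_0_iff_both_eq_0 lookup_add not_in_keys_iff_lookup_eq_zero)
  have "finite ((\<lambda>a. restrict (Poly_Mapping.lookup a) (Poly_Mapping.keys m)) ` {a. \<exists>b. a + b = m})"
  proof (rule finite_subset)
    show "(\<lambda>a. restrict (Poly_Mapping.lookup a) (Poly_Mapping.keys m)) ` {a. \<exists>b. a + b = m} \<subseteq> ?T"
      by (auto simp: lookup_add)
    show "finite ?T" by (intro finite_PiE) auto
  qed
  moreover have "inj_on (\<lambda>a. restrict (Poly_Mapping.lookup a) (Poly_Mapping.keys m)) {a. \<exists>b. a + b = m}"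
  proof (rule inj_onI)
    fix a a' :: "nat \<Rightarrow>\<^sub>0 nat"
    assume ab: "a \<in> {a. \<exists>b. a + b = m}" "a' \<in> {a. \<exists>b. a + b = m}"
      and eq: "restrict (Poly_Mapping.lookup a) (Poly_Mapping.keys m)
             = restrict (Poly_Mapping.lookup a') (Poly_Mapping.keys m)"
    show "a = a'"
    proof (rule poly_mapping_eqI)
      fix i show "Poly_Mapping.lookup a i = Poly_Mapping.lookup a' i"
        using ab * [of a _ i] * [of a' _ i] fun_cong [OF eq, of i]
        by (cases "i \<in> Poly_Mapping.keys m") auto
    qed
  qed
  ultimately have fin: "finite {a. \<exists>b. a + b = m}" by (rule finite_imageD)
  have "{(a, b). a + b = m} \<subseteq> (\<lambda>a. (a, m - a)) ` {a. \<exists>b. a + b = m}"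
    by auto
  then show ?thesis using fin finite_surj by blast
qed

instantiation mps :: (comm_ring_1) comm_ring_1
begin

lift_definition zero_mps :: "'a mps" is "\<lambda>_. 0" .
lift_definition one_mps :: "'a mps" is "\<lambda>m. if m = 0 then 1 else 0" .
lift_definition plus_mps :: "'a mps \<Rightarrow> 'a mps \<Rightarrow> 'a mps" is "\<lambda>f g m. f m + g m" .
lift_definition minus_mps :: "'a mps \<Rightarrow> 'a mps \<Rightarrow> 'a mps" is "\<lambda>f g m. f m - g m" .
lift_definition uminus_mps :: "'a mps \<Rightarrow> 'a mps" is "\<lambda>f m. - f m" .
lift_definition times_mps :: "'a mps \<Rightarrow> 'a mps \<Rightarrow> 'a mps"
  is "\<lambda>f g m. \<Sum>(a, b) \<in> {(a, b). a + b = m}. f a * g b" .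

instance
proof
  fix f g h :: "'a mps"
  show "f + g + h = f + (g + h)" "f + g = g + f" "0 + f = f" "- f + f = 0" "f - g = f + - g"
    by (transfer; auto simp: add_ac)+
  show "(0 :: 'a mps) \<noteq> 1"
    by transfer (metis zero_neq_one)
  show "(f + g) * h = f * h + g * h"
    by transfer (simp add: distrib_right sum.distrib split_def)
  show "f * g = g * f"
  proof (transfer, rule ext)
    fix f g :: "(nat \<Rightarrow>\<^sub>0 nat) \<Rightarrow> 'a" and m :: "nat \<Rightarrow>\<^sub>0 nat"
    show "(\<Sum>(a, b) \<in> {(a, b). a + b = m}. f a * g b) = (\<Sum>(a, b) \<in> {(a, b). a + b = m}. g a * f b)"
      by (rule sum.reindex_bij_witness [of _ prod.swap prod.swap]) (auto simp: add.commute mult.commute)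
  qed
  show "1 * f = f"
  proof (transfer, rule ext)
    fix f :: "(nat \<Rightarrow>\<^sub>0 nat) \<Rightarrow> 'a" and m :: "nat \<Rightarrow>\<^sub>0 nat"
    have "(\<Sum>(a, b) \<in> {(a, b). a + b = m}. (if a = 0 then 1 else 0) * f b)
        = (\<Sum>(a, b) \<in> {(0 :: nat \<Rightarrow>\<^sub>0 nat, m)}. (if a = 0 then 1 else 0) * f b)"
      by (rule sum.mono_neutral_right) (auto simp: finite_splits split: if_splits)
    then show "(\<Sum>(a, b) \<in> {(a, b). a + b = m}. (if a = 0 then 1 else 0) * f b) = f m"
      by simp
  qed
  show "f * g * h = f * (g * h)"
  proof (transfer, rule ext)
    fix f g h :: "(nat \<Rightarrow>\<^sub>0 nat) \<Rightarrow> 'a" and m :: "nat \<Rightarrow>\<^sub>0 nat"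
    have "(\<Sum>(d, c) \<in> {(d, c). d + c = m}. (\<Sum>(a, b) \<in> {(a, b). a + b = d}. f a * g b) * h c)
        = (\<Sum>p \<in> {(d, c). d + c = m}. \<Sum>q \<in> {(a, b). a + b = fst p}. f (fst q) * g (snd q) * h (snd p))"
      by (simp add: split_def sum_distrib_right)
    also have "\<dots> = (\<Sum>(p, q) \<in> (SIGMA p : {(d, c). d + c = m}. {(a, b). a + b = fst p}).
                      f (fst q) * g (snd q) * h (snd p))"
      by (rule sum.Sigma) (auto simp: finite_splits)
    also have "\<dots> = (\<Sum>(p, q) \<in> (SIGMA p : {(a, e). a + e = m}. {(b, c). b + c = snd p}).
                      f (fst p) * (g (fst q) * h (snd q)))"
      by (rule sum.reindex_bij_witness
           [of _ "\<lambda>(p, q). ((fst p + fst q, snd q), (fst p, fst q))"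
                 "\<lambda>(p, q). ((fst q, snd q + snd p), (snd q, snd p))"])
         (auto simp: add.assoc mult.assoc)
    also have "\<dots> = (\<Sum>p \<in> {(a, e). a + e = m}. \<Sum>q \<in> {(b, c). b + c = snd p}.
                      f (fst p) * (g (fst q) * h (snd q)))"
      by (rule sum.Sigma [symmetric]) (auto simp: finite_splits)
    also have "\<dots> = (\<Sum>(a, e) \<in> {(a, e). a + e = m}. f a * (\<Sum>(b, c) \<in> {(b, c). b + c = e}. g b * h c))"
      by (simp add: split_def sum_distrib_left)
    finally show "(\<Sum>(d, c) \<in> {(d, c). d + c = m}. (\<Sum>(a, b) \<in> {(a, b). a + b = d}. f a * g b) * h c)
        = (\<Sum>(a, e) \<in> {(a, e). a + e = m}. f a * (\<Sum>(b, c) \<in> {(b, c). b + c = e}. g b * h c))" .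
  qed
qed

end

text \<open>The multiplicative inverse in the ring of power series (by convention 0 for non-units).\<close>

instantiation mps :: (comm_ring_1) inverse
begin

definition inverse_mps :: "'a mps \<Rightarrow> 'a mps" where
  "inverse f = (if \<exists>g. f * g = 1 then THE g. f * g = 1 else 0)" for f :: "'a mps"

definition divide_mps :: "'a mps \<Rightarrow> 'a mps \<Rightarrow> 'a mps" where
  "f div g = f * inverse g" for f g :: "'a mps"

instance ..

end

lemma mps_inverse_unique:
  fixes f g :: "'a :: comm_ring_1 mps"
  assumes "f * g = 1"
  shows "inverse f = g"
proof -
  have "h = g" if "f * h = 1" for h
    using assms that by (metis mult.assoc mult.commute mult_1)
  then have "(THE g. f * g = 1) = g"
    using assms by blast
  then show ?thesis
    using assms by (auto simp: inverse_mps_def)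
qed

definition mps_monom :: "(nat \<Rightarrow>\<^sub>0 nat) \<Rightarrow> 'a :: comm_ring_1 mps" where
  "mps_monom m = Abs_mps (\<lambda>n. if n = m then 1 else 0)"

definition X :: "nat \<Rightarrow> 'a :: comm_ring_1 mps" where
  "X i = mps_monom (Poly_Mapping.single i 1)"

lemma coeff_monom_times:
  "mps_coeff (mps_monom m * f) p = (if \<exists>b. p = m + b then mps_coeff f (p - m) else 0)"
proof -
  let ?c = "\<lambda>(a, b). (if a = m then 1 else 0) * mps_coeff f b"
  have eq: "mps_coeff (mps_monom m * f) p = sum ?c {(a, b). a + b = p}"
    by (simp add: times_mps.rep_eq mps_monom_def Abs_mps_inverse)
  show ?thesis
  proof (cases "\<exists>b. p = m + b")
    case True
    then obtain b where b: "p = m + b" by blast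
    have "sum ?c {(a, b). a + b = p} = sum ?c {(m, b)}"
      by (rule sum.mono_neutral_right) (auto simp: finite_splits b split: if_splits)
    then show ?thesis using eq b by auto
  next
    case False
    then have "sum ?c {(a, b). a + b = p} = 0"
      by (intro sum.neutral) auto
    then show ?thesis using eq False by simp
  qed
qed

lemma mps_monom_mult:
  "mps_monom m * mps_monom n = (mps_monom (m + n) :: 'a :: comm_ring_1 mps)"
proof (rule mps_eqI)
  fix p
  show "mps_coeff (mps_monom m * mps_monom n) p = mps_coeff (mps_monom (m + n) :: 'a mps) p"
    unfolding coeff_monom_times by (auto simp: mps_monom_def Abs_mps_inverse)
qed

text \<open>The denominators \<open>1 - x\<^sub>i\<close> and \<open>1 - x\<^sub>i x\<^sub>j\<close> are units, so dividing by them is meaningful.\<close>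

lemma one_minus_monom_inverse:
  assumes "m \<noteq> 0"
  shows "(1 - mps_monom m) * inverse (1 - mps_monom m) = (1 :: 'a :: comm_ring_1 mps)"
proof -
  let ?P = "\<lambda>p. \<exists>n. p = (((+) m) ^^ n) 0"
  define g :: "'a mps" where "g = Abs_mps (\<lambda>p. if ?P p then 1 else 0)"
  have g: "mps_coeff g p = (if ?P p then 1 else 0)" for p
    by (simp add: g_def Abs_mps_inverse)
  have step: "?P p \<longleftrightarrow> p = 0 \<or> (\<exists>b. p = m + b \<and> ?P b)" for p
  proof
    assume "?P p"
    then obtain n where "p = (((+) m) ^^ n) 0" by blast
    then show "p = 0 \<or> (\<exists>b. p = m + b \<and> ?P b)" by (cases n) auto
  next
    assume "p = 0 \<or> (\<exists>b. p = m + b \<and> ?P b)"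
    then show "?P p"
    proof
      assume "p = 0" then show ?thesis by (intro exI [of _ 0]) simp
    next
      assume "\<exists>b. p = m + b \<and> ?P b"
      then obtain n where "p = m + (((+) m) ^^ n) 0" by blast
      then show ?thesis by (intro exI [of _ "Suc n"]) simp
    qed
  qed
  have nz: "m + b \<noteq> 0" for b
  proof
    assume *: "m + b = 0"
    have "m = 0"
    proof (rule poly_mapping_eqI)
      fix i show "Poly_Mapping.lookup m i = Poly_Mapping.lookup 0 i"
        using arg_cong [OF *, of "\<lambda>q. Poly_Mapping.lookup q i"] by (simp add: lookup_add)
    qed
    with assms show False ..
  qed
  have "(1 - mps_monom m) * g = 1"
  proof (rule mps_eqI)
    fix p
    have "mps_coeff ((1 - mps_monom m) * g) p = mps_coeff g p - mps_coeff (mps_monom m * g) p"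
      by (simp add: left_diff_distrib minus_mps.rep_eq)
    also have "\<dots> = mps_coeff 1 p"
    proof (cases "\<exists>b. p = m + b")
      case True
      then obtain b where b: "p = m + b" by blast
      then show ?thesis
        using nz [of b] step [of p] by (simp add: coeff_monom_times g one_mps.rep_eq)
    next
      case False
      then show ?thesis
        using step [of p] by (auto simp: coeff_monom_times g one_mps.rep_eq)
    qed
    finally show "mps_coeff ((1 - mps_monom m) * g) p = mps_coeff 1 p" .
  qed
  then show ?thesis using mps_inverse_unique by metis
qed

lemma one_minus_X_inverse:
  "(1 - X i) * inverse (1 - X i) = (1 :: 'a :: comm_ring_1 mps)"
  unfolding X_def by (rule one_minus_monom_inverse) (simp add: poly_mapping_eq_iff fun_eq_iff lookup_single when_def)

lemma one_minus_XX_inverse: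
  "(1 - X i * X j) * inverse (1 - X i * X j) = (1 :: 'a :: comm_ring_1 mps)"
  unfolding X_def mps_monom_mult
  by (rule one_minus_monom_inverse)
     (auto simp: poly_mapping_eq_iff fun_eq_iff lookup_single lookup_add when_def)

text \<open>
  Evaluation of a series \<open>F\<close> in the variables \<open>x\<^sub>1, \<dots>, x\<^sub>m\<close> at a list \<open>ys\<close> of \<open>m\<close> variable indices:
  \<open>x\<^sub>a\<close> is replaced by \<open>x\<^bsub>ys ! (a - 1)\<^esub>\<close> (list positions start at 0, variables at 1), so that a
  monomial with exponent vector \<open>n\<close> becomes the one with exponent vector \<open>rename_monom ys n\<close>.
\<close>

definition rename_monom :: "nat list \<Rightarrow> (nat \<Rightarrow>\<^sub>0 nat) \<Rightarrow> (nat \<Rightarrow>\<^sub>0 nat)" where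
  "rename_monom ys n = (\<Sum>a<length ys. Poly_Mapping.single (ys ! a) (Poly_Mapping.lookup n (Suc a)))"

definition eval_at_vars :: "'a :: comm_ring_1 mps \<Rightarrow> nat list \<Rightarrow> 'a mps" where
  "eval_at_vars F ys =
     Abs_mps (\<lambda>m. \<Sum>n | Poly_Mapping.keys n \<subseteq> {1..length ys} \<and> rename_monom ys n = m. mps_coeff F n)"

text \<open>
  The hat notation: \<open>hat k R F\<close> is \<open>F\<close> evaluated at the variables \<open>x\<^sub>1, \<dots>, x\<^sub>k\<close> with those \<open>x\<^sub>i\<close> having
  \<open>i \<in> R\<close> deleted, in increasing order of index.
\<close>

definition hat :: "nat \<Rightarrow> nat set \<Rightarrow> 'a :: comm_ring_1 mps \<Rightarrow> 'a mps" where
  "hat k R F = eval_at_vars F (filter (\<lambda>i. i \<notin> R) [1..<Suc k])"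


section \<open>Unimodal involutions\<close>

text \<open>
  A permutation of \<open>[n]\<close> is a function \<open>\<pi>\<close> with \<open>\<pi> permutes {1..n}\<close>; its one-line notation is
  \<open>\<pi> 1, \<dots>, \<pi> n\<close>.
\<close>

text \<open>
  \<open>compositions k\<close> is \<open>\<Lambda>\<^sub>k\<close>.  For \<open>k = 0\<close> it consists of the empty composition (of 0), which
  accounts for the convention \<open>L\<^sup>0 = 1\<close>.
\<close>

definition compositions :: "nat \<Rightarrow> nat list set" where
  "compositions k = {lam. length lam = k \<and> (\<forall>p\<in>set lam. 0 < p)}"

definition psum :: "nat list \<Rightarrow> nat \<Rightarrow> nat" where
  "psum lam i = sum_list (take i lam)"

text \<open>Purely increasing and purely decreasing segments count as unimodal: the peak at \<open>c\<close> belongs to both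
  monotone pieces, either of which may consist of the peak alone.\<close>

definition unimodal_between :: "nat \<Rightarrow> nat \<Rightarrow> (nat \<Rightarrow> nat) \<Rightarrow> bool" where
  "unimodal_between a b \<pi> \<longleftrightarrow>
     (\<exists>c\<in>{a..b}. strict_mono_on {a..c} \<pi> \<and> strict_antimono_on {c..b} \<pi>)"

definition unimodal_perm :: "nat list \<Rightarrow> (nat \<Rightarrow> nat) \<Rightarrow> bool" where
  "unimodal_perm lam \<pi> \<longleftrightarrow>
     (\<forall>i<length lam. unimodal_between (psum lam i + 1) (psum lam (i + 1)) \<pi>)"

definition unimodal_invs :: "nat list \<Rightarrow> (nat \<Rightarrow> nat) set" where
  "unimodal_invs lam = {\<pi>. \<pi> permutes {1..sum_list lam} \<and> inv \<pi> = \<pi> \<and> unimodal_perm lam \<pi>}"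

definition unimodal_invs_j :: "nat \<Rightarrow> nat list \<Rightarrow> (nat \<Rightarrow> nat) set" where
  "unimodal_invs_j j lam = {\<pi> \<in> unimodal_invs lam.
     \<pi> 1 \<le> psum lam j \<and> strict_antimono_on {1..lam ! 0} \<pi> \<or> \<pi> 1 > psum lam j}"

definition decr_invs :: "nat \<Rightarrow> nat list \<Rightarrow> (nat \<Rightarrow> nat) set" where
  "decr_invs i lam = {\<pi> \<in> unimodal_invs lam.
     \<pi> 1 \<le> psum lam i \<and> strict_antimono_on {1..lam ! 0} \<pi>}"


section \<open>Generating functions\<close>

definition comp_monom :: "nat list \<Rightarrow> (nat \<Rightarrow>\<^sub>0 nat)" where
  "comp_monom lam = (\<Sum>i<length lam. Poly_Mapping.single (Suc i) (lam ! i))"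

text \<open>\<open>comp_monom lam\<close> is the exponent vector of \<open>x^lam\<close> (list position \<open>i\<close> belongs to \<open>x\<^bsub>i + 1\<^esub>\<close>).
  \<open>comp_series k c\<close> is the formal sum of \<open>c lam\<close> times \<open>x^lam\<close> over all compositions \<open>lam\<close> with \<open>k\<close> parts.\<close>

definition comp_series :: "nat \<Rightarrow> (nat list \<Rightarrow> nat) \<Rightarrow> int mps" where
  "comp_series k c =
     Abs_mps (\<lambda>m. \<Sum>lam | lam \<in> compositions k \<and> comp_monom lam = m. int (c lam))"

lemma lookup_comp_monom:
  "Poly_Mapping.lookup (comp_monom lam) (Suc i) = (if i < length lam then lam ! i else 0)"
  by (simp add: comp_monom_def lookup_sum lookup_single when_def)

lemma comp_monom_inj:
  assumes "length lam = length mu" "comp_monom lam = comp_monom mu"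
  shows "lam = mu"
  using assms by (metis lookup_comp_monom nth_equalityI)

lemma coeff_comp_series:
  assumes "lam \<in> compositions k"
  shows "mps_coeff (comp_series k c) (comp_monom lam) = int (c lam)"
proof -
  have "{mu. mu \<in> compositions k \<and> comp_monom mu = comp_monom lam} = {lam}"
    using assms by (auto simp: compositions_def dest: comp_monom_inj)
  then show ?thesis by (simp add: comp_series_def Abs_mps_inverse)
qed

text \<open>\<open>L k\<close>, \<open>LJ k j\<close> and \<open>D k i\<close> are \<open>L\<^sup>k\<close>, \<open>L\<^sup>k\<^sub>j\<close> and \<open>D\<^sup>k\<^sub>i\<close>.\<close>

definition L :: "nat \<Rightarrow> int mps" where
  "L k = comp_series k (\<lambda>lam. card (unimodal_invs lam))"

definition LJ :: "nat \<Rightarrow> nat \<Rightarrow> int mps" where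
  "LJ k j = comp_series k (\<lambda>lam. card (unimodal_invs_j j lam))"

definition D :: "nat \<Rightarrow> nat \<Rightarrow> int mps" where
  "D k i = comp_series k (\<lambda>lam. card (decr_invs i lam))"

end

theory Submission
  imports Defs
begin

text \<open>
  In an involution \<open>\<pi>\<close> with \<open>\<pi> 1 = m > 1\<close> the minimum 1 is at position \<open>m\<close>, so unimodality forces \<open>m\<close> to be
  the first or the last position of its segment.  Removing the cycle \<open>(1 m)\<close> and standardizing gives a
  unimodal involution \<open>\<sigma>\<close> for the composition with the first part and the part of the segment of \<open>m\<close>
  decreased by 1.  Conversely, inserting \<open>(1 m)\<close> into \<open>\<sigma>\<close> keeps the first segment unimodal iff that
  segment of \<open>\<sigma>\<close> is decreasing or \<open>\<sigma> 1 > m - 2\<close>, and \<open>m - 2\<close> is a partial sum of the new composition; it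
  keeps it decreasing iff it is decreasing and \<open>\<sigma> 1 \<le> m - 2\<close>.  Comparing coefficients, with separate
  terms for the parts that become 0, gives the recurrences.
\<close>

section \<open>Removing the cycle of 1 from an involution\<close>

text \<open>The obstacle is that a part of size 1 is used up by the removal, so \<sigma> need not
  belong to a composition. All counts are therefore made on cut sets, where an empty segment leaves
  no trace: the same number can be read off the list with the zero or the list without it. The
  second reading is a coefficient of a hatted series, so every hatted series can be rewritten in all
  \<open>k\<close> variables, supported on the exponent vectors with zeros exactly at the deleted
  places. The first and the last position of a segment contribute separately unless the segment has
  length 1. If the first part is used up, \<sigma> satisfies no extra condition and the two
  contributions agree; this is the origin of the factor 2. The denominators come from elsewhere:
  removing a cycle can lead back to the series that is being computed, and these terms are collected
  on the left.\<close>

definition involutions :: "nat \<Rightarrow> (nat \<Rightarrow> nat) set" where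
  "involutions n = {\<pi>. \<pi> permutes {1..n} \<and> inv \<pi> = \<pi>}"

text \<open>The pointwise form speaks about all natural numbers, with the identity outside
  \<open>{1..n}\<close>. So injectivity needs no range conditions, and only 0 is mapped to 0, which
  makes 1 the least value at positive positions.\<close>

lemma involutions_iff:
  "\<pi> \<in> involutions n \<longleftrightarrow> (\<forall>x. \<pi> (\<pi> x) = x) \<and> (\<forall>x. x \<notin> {1..n} \<longrightarrow> \<pi> x = x)"
proof
  assume "\<pi> \<in> involutions n"
  then have p: "\<pi> permutes {1..n}" "inv \<pi> = \<pi>" by (auto simp: involutions_def)
  then show "(\<forall>x. \<pi> (\<pi> x) = x) \<and> (\<forall>x. x \<notin> {1..n} \<longrightarrow> \<pi> x = x)"
    by (metis permutes_inverses(2) permutes_not_in)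
next
  assume a: "(\<forall>x. \<pi> (\<pi> x) = x) \<and> (\<forall>x. x \<notin> {1..n} \<longrightarrow> \<pi> x = x)"
  then have "\<pi> permutes {1..n}" unfolding permutes_def by metis
  moreover have "inv \<pi> = \<pi>" using a by (intro inv_equality) auto
  ultimately show "\<pi> \<in> involutions n" by (simp add: involutions_def)
qed

lemma finite_involutions [simp]: "finite (involutions n)"
  by (rule finite_subset [OF _ finite_permutations [of "{1..n}"]]) (auto simp: involutions_def)

lemma involutions_inj: "\<pi> \<in> involutions n \<Longrightarrow> \<pi> x = \<pi> y \<longleftrightarrow> x = y"
  by (metis involutions_iff)

lemma involutions_in: "\<pi> \<in> involutions n \<Longrightarrow> \<pi> x \<in> {1..n} \<longleftrightarrow> x \<in> {1..n}"
  by (metis involutions_iff)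

lemma involutions_0: "\<pi> \<in> involutions n \<Longrightarrow> \<pi> x = 0 \<longleftrightarrow> x = 0"
  by (metis involutions_iff atLeastAtMost_iff not_one_le_zero)

text \<open>
  A sequence of distinct numbers is unimodal iff it has no valley.  In this form the condition depends
  only on the set of cut points between segments, which makes sense for empty segments, too.
\<close>

definition valley_free :: "nat \<Rightarrow> nat set \<Rightarrow> (nat \<Rightarrow> nat) \<Rightarrow> bool" where
  "valley_free n P \<pi> \<longleftrightarrow> (\<forall>x y z. 1 \<le> x \<and> x < y \<and> y < z \<and> z \<le> n \<and> {x..<z} \<inter> P = {} \<longrightarrow>
     \<not> (\<pi> y < \<pi> x \<and> \<pi> y < \<pi> z))"

definition VF :: "nat \<Rightarrow> nat set \<Rightarrow> (nat \<Rightarrow> nat) set" where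
  "VF n P = {\<pi> \<in> involutions n. valley_free n P \<pi>}"

lemma finite_VF [simp]: "finite (VF n P)"
  by (simp add: VF_def)

text \<open>
  \<open>skip m\<close> is the order isomorphism from the positive integers onto those different from 1 and \<open>m\<close>;
  \<open>unskip m s\<close> is the number of elements of \<open>{1..s}\<close> different from 1 and \<open>m\<close>.  Thus \<open>ins m \<sigma>\<close> adds the
  cycle \<open>(1 m)\<close> to \<open>\<sigma>\<close>, where \<open>m = 1\<close> is a fixed point.
\<close>

definition skip :: "nat \<Rightarrow> nat \<Rightarrow> nat" where
  "skip m x = (if x = 0 then 0 else if m \<le> 1 \<or> Suc x < m then Suc x else Suc (Suc x))"

definition unskip :: "nat \<Rightarrow> nat \<Rightarrow> nat" where
  "unskip m x = (if m \<le> 1 \<or> x < m then x - 1 else x - 2)"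

definition ins :: "nat \<Rightarrow> (nat \<Rightarrow> nat) \<Rightarrow> nat \<Rightarrow> nat" where
  "ins m \<sigma> y = (if y = 1 then m else if y = m then 1 else skip m (\<sigma> (unskip m y)))"

lemma skip_0 [simp]: "skip m 0 = 0" "unskip m 0 = 0"
  by (auto simp: skip_def unskip_def)

lemma skip_eq_0 [simp]: "skip m x = 0 \<longleftrightarrow> x = 0"
  by (auto simp: skip_def)

lemma unskip_skip [simp]: "unskip m (skip m x) = x"
  by (auto simp: skip_def unskip_def)

lemma skip_unskip: "y \<noteq> 1 \<Longrightarrow> y \<noteq> m \<Longrightarrow> skip m (unskip m y) = y"
  by (auto simp: skip_def unskip_def)

lemma skip_neq: "1 \<le> m \<Longrightarrow> skip m x \<noteq> 1" "1 \<le> m \<Longrightarrow> skip m x \<noteq> m"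
  by (auto simp: skip_def)

lemma skip_less [simp]: "skip m x < skip m y \<longleftrightarrow> x < y"
  by (auto simp: skip_def)

lemma skip_eq [simp]: "skip m x = skip m y \<longleftrightarrow> x = y"
  by (auto simp: skip_def)

text \<open>\<open>skip m\<close> and \<open>unskip m\<close> are adjoint, so a bound after the
  relabelling translates into a bound before it. Cut sets are transported by the same
  \<open>unskip m\<close>.\<close>

lemma skip_le: "1 \<le> m \<Longrightarrow> skip m x \<le> s \<longleftrightarrow> x \<le> unskip m s"
  by (auto simp: skip_def unskip_def)

lemma skip_cases: "1 \<le> m \<Longrightarrow> y = 1 \<or> y = m \<or> (\<exists>x. y = skip m x)"
  by (metis skip_unskip)

lemma skip_less_m: "2 \<le> m \<Longrightarrow> skip m x < m \<longleftrightarrow> Suc x < m"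
  by (auto simp: skip_def)

lemma ins_simps [simp]:
  assumes "1 \<le> m"
  shows "ins m \<sigma> 1 = m" "ins m \<sigma> m = 1" "ins m \<sigma> (skip m x) = skip m (\<sigma> x)"
    "ins m \<sigma> (Suc 0) = m"
  using assms skip_neq by (auto simp: ins_def)

lemma ins_involution:
  assumes m: "1 \<le> m" "m \<le> n" and s: "\<sigma> \<in> involutions (unskip m n)"
  shows "ins m \<sigma> \<in> involutions n"
  unfolding involutions_iff
proof (intro conjI allI impI)
  fix y
  show "ins m \<sigma> (ins m \<sigma> y) = y"
    using skip_cases [OF m(1), of y] m s by (auto simp: involutions_iff)
next
  fix y assume y: "y \<notin> {1..n}"
  then have "y \<noteq> 1" "y \<noteq> m" using m by auto
  then obtain x where x: "y = skip m x" using skip_cases m by blast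
  then have "x \<notin> {1..unskip m n}" using y skip_le [OF m(1), of x n] skip_eq_0 [of m x]
    by (auto simp: Suc_le_eq simp del: skip_eq_0)
  then show "ins m \<sigma> y = y" using s x m by (auto simp: involutions_iff)
qed

lemma remove_involution:
  assumes m: "1 \<le> m" "m \<le> n" and p: "\<pi> \<in> involutions n" and p1: "\<pi> 1 = m"
  obtains \<sigma> where "\<sigma> \<in> involutions (unskip m n)" "\<pi> = ins m \<sigma>"
proof
  let ?s = "\<lambda>x. unskip m (\<pi> (skip m x))"
  have pp: "\<pi> (\<pi> x) = x" for x using p by (simp add: involutions_iff)
  have ne: "\<pi> (skip m x) \<noteq> 1" "\<pi> (skip m x) \<noteq> m" for x
    using pp p1 skip_neq [OF m(1)] by metis+
  have eq: "skip m (?s x) = \<pi> (skip m x)" for x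
    using ne by (simp add: skip_unskip)
  show "?s \<in> involutions (unskip m n)"
    unfolding involutions_iff
  proof (intro conjI allI impI)
    fix x show "?s (?s x) = x" using eq pp by simp
  next
    fix x assume "x \<notin> {1..unskip m n}"
    then have "skip m x \<notin> {1..n}" using skip_le [OF m(1), of x n] by (cases "x = 0") auto
    then show "?s x = x" using p by (simp add: involutions_iff)
  qed
  show "\<pi> = ins m ?s"
  proof
    fix y
    have "\<pi> m = 1" using pp p1 by metis
    then show "\<pi> y = ins m ?s y"
      using skip_cases [OF m(1), of y] eq p1 m(1) by auto
  qed
qed

lemma ins_inj: "1 \<le> m \<Longrightarrow> inj (ins m)"
proof (rule injI, rule ext)
  fix \<sigma> \<tau> x assume "1 \<le> m" "ins m \<sigma> = ins m \<tau>"
  then show "\<sigma> x = \<tau> x" by (metis ins_simps(3) skip_eq)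
qed

text \<open>Insertion is a bijection onto the involutions with value \<open>m\<close> at 1, so
  counting them only requires translating the property \<open>Q\<close> across the
  insertion.\<close>

lemma card_ins:
  assumes m: "1 \<le> m" "m \<le> n"
    and eq: "\<And>\<sigma>. \<sigma> \<in> involutions (unskip m n) \<Longrightarrow> Q (ins m \<sigma>) \<longleftrightarrow> R \<sigma>"
  shows "card {\<pi> \<in> involutions n. Q \<pi> \<and> \<pi> 1 = m} = card {\<sigma> \<in> involutions (unskip m n). R \<sigma>}"
proof -
  have "{\<pi> \<in> involutions n. Q \<pi> \<and> \<pi> 1 = m} = ins m ` {\<sigma> \<in> involutions (unskip m n). R \<sigma>}"
    (is "?l = ?r")
  proof
    show "?l \<subseteq> ?r"
    proof
      fix \<pi> assume p: "\<pi> \<in> ?l"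
      then obtain \<sigma> where "\<sigma> \<in> involutions (unskip m n)" "\<pi> = ins m \<sigma>"
        using remove_involution [OF m, of \<pi>] by auto
      then show "\<pi> \<in> ?r" using p eq by auto
    qed
    show "?r \<subseteq> ?l" using m eq ins_involution by auto
  qed
  then show ?thesis using ins_inj [OF m(1)] by (simp add: card_image inj_on_def)
qed

section \<open>Valleys before and after the insertion of a cycle\<close>

lemma skip_cut:
  assumes "1 \<le> m"
  shows "{skip m x..<skip m z} \<inter> P = {} \<longleftrightarrow> {x..<z} \<inter> unskip m ` P = {}"
proof -
  \<comment> \<open>A cut \<open>p\<close> separates the positions \<open>p\<close> and
    \<open>p + 1\<close>, hence the half-open intervals; the adjunction applies at both
    ends.\<close>
  have "skip m x \<le> p \<and> p < skip m z \<longleftrightarrow> x \<le> unskip m p \<and> unskip m p < z" for p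
    using skip_le [OF assms] by (meson not_less)
  then show ?thesis by (auto simp: disjoint_iff)
qed

text \<open>\<open>skip m\<close> is strictly increasing on positions and on values, so every valley
  of \<sigma> survives the insertion, whether \<open>m\<close> is 1 or not.\<close>

lemma valley_free_skip:
  assumes m: "1 \<le> m"
    and v: "valley_free n P (ins m \<sigma>)"
  shows "valley_free (unskip m n) (unskip m ` P) \<sigma>"
  unfolding valley_free_def
proof (intro allI impI)
  fix x y z
  assume *: "1 \<le> x \<and> x < y \<and> y < z \<and> z \<le> unskip m n \<and> {x..<z} \<inter> unskip m ` P = {}"
  then have "{skip m x..<skip m z} \<inter> P = {}" "skip m z \<le> n" "skip m x < skip m y" "skip m y < skip m z"
    using m by (auto simp: skip_cut skip_le)
  moreover have "1 \<le> skip m x" using * by (simp add: Suc_le_eq) (metis neq0_conv skip_eq_0)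
  ultimately have "\<not> (ins m \<sigma> (skip m y) < ins m \<sigma> (skip m x) \<and> ins m \<sigma> (skip m y) < ins m \<sigma> (skip m z))"
    using v unfolding valley_free_def by blast
  then show "\<not> (\<sigma> y < \<sigma> x \<and> \<sigma> y < \<sigma> z)" using m by simp
qed

text \<open>A valley after the insertion has one of three forms, excluded by the three conditions:
  its bottom is position \<open>m\<close>, which carries the least value 1; or it avoids 1 and
  \<open>m\<close> and comes from \<sigma>; or its left end is position 1, with value
  \<open>m\<close>. Position \<open>m\<close> is too low to be an end of a valley. Here
  \<open>t\<close> is the last position of the first segment.\<close>

lemma valley_free_ins:
  assumes m: "2 \<le> m" "m \<le> n" and n: "n \<in> P" and t: "t \<in> P" "t \<le> n" "{1..<t} \<inter> P = {}" "1 \<le> t"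
    and s: "\<sigma> \<in> involutions (unskip m n)"
  shows "valley_free n P (ins m \<sigma>) \<longleftrightarrow> (m - 1 \<in> P \<or> m \<in> P) \<and>
    valley_free (unskip m n) (unskip m ` P) \<sigma> \<and>
    (\<forall>y z. 1 \<le> y \<and> y < z \<and> z \<le> unskip m t \<and> \<sigma> y < \<sigma> z \<longrightarrow> m \<le> Suc (\<sigma> y))"
    (is "?l \<longleftrightarrow> ?c \<and> ?v \<and> ?d")
proof
  have m1: "1 \<le> m" using m by simp
  have first: "{1..<z} \<inter> P = {} \<longleftrightarrow> z \<le> t" if "z \<ge> 1" for z
  proof -
    have "{1..<z} \<subseteq> {1..<t}" if "z \<le> t" using that by auto
    moreover have "t \<in> {1..<z} \<inter> P" if "\<not> z \<le> t" using that t by auto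
    ultimately show ?thesis using t(3) by blast
  qed
  note p0 = involutions_0 [OF ins_involution [OF m1 m(2) s]]
  {
    assume v: ?l
    have ?c
    proof (rule ccontr)
      \<comment> \<open>Without these cuts \<open>m - 1\<close>, \<open>m\<close> and
        \<open>m + 1\<close> lie in one segment; \<open>m < n\<close> because \<open>n\<close> is a
        cut.\<close>
      assume c: "\<not> ?c"
      then have "m \<noteq> n" using n by blast
      then have mn: "m < n" using m by simp
      have "{m-1..<Suc m} = {m-1,m}" using m by auto
      then have cut: "{m-1..<Suc m} \<inter> P = {}" using c by simp
      have big: "1 < ins m \<sigma> y" if "y \<noteq> 0" "y \<noteq> m" for y
      proof -
        have "ins m \<sigma> y \<noteq> ins m \<sigma> m"
          using that involutions_inj [OF ins_involution [OF m1 m(2) s]] by blast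
        then show ?thesis using that p0 [of y] m1 by simp
      qed
      have "\<not> (ins m \<sigma> m < ins m \<sigma> (m - 1) \<and> ins m \<sigma> m < ins m \<sigma> (Suc m))"
        using v [unfolded valley_free_def, rule_format, of "m - 1" m "Suc m"] m mn cut by linarith
      then show False using big [of "m - 1"] big [of "Suc m"] m m1 by simp
    qed
    moreover have ?v using valley_free_skip m1 v by blast
    moreover have ?d
    proof (intro allI impI)
      fix y z assume *: "1 \<le> y \<and> y < z \<and> z \<le> unskip m t \<and> \<sigma> y < \<sigma> z"
      then have "skip m z \<le> t" using m1 by (simp add: skip_le)
      moreover have "1 < skip m y" using * skip_neq(1) [OF m1, of y]
        by (metis One_nat_def Suc_le_lessD less_one nat_neq_iff skip_eq_0 not_less_zero)
      moreover have "skip m y < skip m z" using * by simp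
      moreover have "{1..<skip m z} \<inter> P = {}" using first [of "skip m z"] calculation by linarith
      ultimately have "\<not> (ins m \<sigma> (skip m y) < ins m \<sigma> 1 \<and> ins m \<sigma> (skip m y) < ins m \<sigma> (skip m z))"
        using v t(2) unfolding valley_free_def by (meson le_refl order.trans)
      then have "\<not> skip m (\<sigma> y) < m" using * m1 by simp
      then show "m \<le> Suc (\<sigma> y)" using skip_less_m [OF m(1)] by simp
    qed
    ultimately show "?c \<and> ?v \<and> ?d" by blast
  }
  assume cvd: "?c \<and> ?v \<and> ?d"
  show ?l
    unfolding valley_free_def
  proof (intro allI impI notI)
    fix x y z
    assume *: "1 \<le> x \<and> x < y \<and> y < z \<and> z \<le> n \<and> {x..<z} \<inter> P = {}"
      and **: "ins m \<sigma> y < ins m \<sigma> x \<and> ins m \<sigma> y < ins m \<sigma> z"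
    have "x \<noteq> m" "z \<noteq> m" using ** * p0 [of y] m1 by auto
    moreover have "y \<noteq> m"
    proof
      assume "y = m"
      then have "m - 1 \<in> {x..<z}" "m \<in> {x..<z}" using * by auto
      then show False using cvd * by blast
    qed
    moreover have "y \<noteq> 1" "z \<noteq> 1" using * by auto
    ultimately obtain y' z' where yz: "y = skip m y'" "z = skip m z'"
      using skip_cases [OF m1] by metis
    show False
    proof (cases "x = 1")
      case True
      then have "skip m z' \<le> t" using first [of z] * yz by auto
      then have "z' \<le> unskip m t" using m1 by (simp add: skip_le)
      moreover have "1 \<le> y'" "y' < z'" using * yz by (auto simp: Suc_le_eq intro: gr0I)
      moreover have "\<sigma> y' < \<sigma> z'" "skip m (\<sigma> y') < m" using ** m1 yz True by auto
      ultimately show False using cvd m skip_less_m by (metis not_less)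
    next
      case False
      then obtain x' where x: "x = skip m x'" using skip_cases [OF m1] \<open>x \<noteq> m\<close> by metis
      have "1 \<le> x'" "x' < y'" "y' < z'" "z' \<le> unskip m n" "{x'..<z'} \<inter> unskip m ` P = {}"
        "\<sigma> y' < \<sigma> x'" "\<sigma> y' < \<sigma> z'"
        using * ** yz x m1 by (auto simp: skip_le skip_cut Suc_le_eq intro: gr0I)
      then show False using cvd unfolding valley_free_def by blast
    qed
  qed
qed

text \<open>A fixed point 1 imposes no condition: position 1 could only be the left end of a valley,
  and no positive position has a value below 1.\<close>

lemma valley_free_ins_1:
  assumes n: "1 \<le> n" and s: "\<sigma> \<in> involutions (unskip 1 n)"
  shows "valley_free n P (ins 1 \<sigma>) \<longleftrightarrow> valley_free (unskip 1 n) (unskip 1 ` P) \<sigma>"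
proof
  assume "valley_free n P (ins 1 \<sigma>)"
  then show "valley_free (unskip 1 n) (unskip 1 ` P) \<sigma>"
    using valley_free_skip by blast
next
  assume v: "valley_free (unskip 1 n) (unskip 1 ` P) \<sigma>"
  note p0 = involutions_0 [OF ins_involution [OF le_refl n s]]
  show "valley_free n P (ins 1 \<sigma>)"
    unfolding valley_free_def
  proof (intro allI impI notI)
    fix x y z
    assume *: "1 \<le> x \<and> x < y \<and> y < z \<and> z \<le> n \<and> {x..<z} \<inter> P = {}"
      and **: "ins 1 \<sigma> y < ins 1 \<sigma> x \<and> ins 1 \<sigma> y < ins 1 \<sigma> z"
    have "x \<noteq> 1" using ** * p0 [of y] by auto
    moreover have "y \<noteq> 1" "z \<noteq> 1" using * by auto
    ultimately obtain x' y' z' where yz: "x = skip 1 x'" "y = skip 1 y'" "z = skip 1 z'"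
      using skip_cases [OF le_refl] by metis
    have "1 \<le> x'" "x' < y'" "y' < z'" "z' \<le> unskip 1 n" "{x'..<z'} \<inter> unskip 1 ` P = {}"
        "\<sigma> y' < \<sigma> x'" "\<sigma> y' < \<sigma> z'"
      using * ** yz by (auto simp: skip_le [OF le_refl, simplified] skip_cut [OF le_refl, simplified] Suc_le_eq intro: gr0I)
    then show False using v unfolding valley_free_def by blast
  qed
qed

text \<open>If \<sigma> y < \<sigma> z within the first segment, then \<sigma> 1 \<le> \<sigma> y,
  since otherwise 1, \<open>y\<close>, \<open>z\<close> would be a valley. So 1 and \<open>z\<close>
  form an ascent as well, with the least possible lower end, and a bound on all ascents is a bound
  on \<sigma> 1.\<close>

lemma valley_free_first_block:
  assumes s: "\<sigma> \<in> involutions n" and v: "valley_free n P \<sigma>" and t: "t \<le> n" "{1..<t} \<inter> P = {}" and m: "2 \<le> m"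
  shows "(\<forall>y z. 1 \<le> y \<and> y < z \<and> z \<le> t \<and> \<sigma> y < \<sigma> z \<longrightarrow> m \<le> Suc (\<sigma> y)) \<longleftrightarrow>
    strict_antimono_on {1..t} \<sigma> \<or> m - 2 < \<sigma> 1"
    (is "?l \<longleftrightarrow> ?r")
proof
  have le: "\<sigma> 1 \<le> \<sigma> y" if yz: "1 \<le> y" "y < z" "z \<le> t" "\<sigma> y < \<sigma> z" for y z
  proof (cases "y = 1")
    case False
    moreover have "{1..<z} \<subseteq> {1..<t}" using yz by auto
    then have "{1..<z} \<inter> P = {}" using t by blast
    ultimately show ?thesis
      using v yz t unfolding valley_free_def
      by (metis le_neq_implies_less le_refl linorder_not_less order.trans)
  qed simp
  {
    assume l: ?l
    show ?r
    proof (rule disjCI)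
      assume "\<not> m - 2 < \<sigma> 1"
      then have lt: "Suc (\<sigma> 1) < m" using m by auto
      show "strict_antimono_on {1..t} \<sigma>"
      proof (rule ccontr)
        assume "\<not> strict_antimono_on {1..t} \<sigma>"
        then obtain y z where yz: "1 \<le> y" "y < z" "z \<le> t" "\<not> \<sigma> y > \<sigma> z"
          unfolding monotone_on_def by auto
        then have "\<sigma> y < \<sigma> z" using involutions_inj [OF s] by (metis linorder_neqE_nat nat_neq_iff)
        have "1 < z" using yz by simp
        have "\<sigma> 1 < \<sigma> z" using le yz \<open>\<sigma> y < \<sigma> z\<close> by (meson le_less_trans)
        then have "m \<le> Suc (\<sigma> 1)" using l yz \<open>1 < z\<close> by blast
        then show False using lt by simp
      qed
    qed
  next
    assume r: ?r
    show ?l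
    proof (intro allI impI)
      fix y z assume *: "1 \<le> y \<and> y < z \<and> z \<le> t \<and> \<sigma> y < \<sigma> z"
      then have "y \<in> {1..t}" "z \<in> {1..t}" by auto
      then have "\<not> strict_antimono_on {1..t} \<sigma>" using * unfolding monotone_on_def
        by (metis less_asym)
      then have "m - 2 < \<sigma> 1" using r by blast
      then show "m \<le> Suc (\<sigma> y)" using le * by fastforce
    qed
  }
qed

text \<open>
  These extend \<open>unimodal_invs_j\<close> and \<open>decr_invs\<close> to compositions with parts 0; \<open>t\<close> is the first part
  and \<open>s\<close> a partial sum.  For \<open>t = 0\<close> neither imposes a condition on \<open>\<sigma>\<close>: then \<open>ins m \<sigma>\<close> has a
  first segment of length 1.
\<close>

definition AS :: "nat \<Rightarrow> nat \<Rightarrow> nat \<Rightarrow> nat set \<Rightarrow> (nat \<Rightarrow> nat) set" where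
  "AS t s n P = {\<sigma> \<in> VF n P. strict_antimono_on {1..t} \<sigma> \<or> s < \<sigma> 1}"

definition DS :: "nat \<Rightarrow> nat \<Rightarrow> nat \<Rightarrow> nat set \<Rightarrow> (nat \<Rightarrow> nat) set" where
  "DS t s n P = {\<sigma> \<in> VF n P. strict_antimono_on {1..t} \<sigma> \<and> (t = 0 \<or> \<sigma> 1 \<le> s)}"

lemma AS_0: "AS 0 s n P = VF n P" and DS_0: "DS 0 s n P = VF n P"
  by (auto simp: AS_def DS_def)

section \<open>Counting involutions with a given value at 1\<close>

lemma card_fix:
  assumes "1 \<le> n"
  shows "card {\<pi> \<in> VF n P. \<pi> 1 = 1} = card (VF (unskip 1 n) (unskip 1 ` P))"
  using card_ins [of 1 n "valley_free n P" "valley_free (unskip 1 n) (unskip 1 ` P)"]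
    valley_free_ins_1 [OF assms] assms
  by (simp add: VF_def)

lemma card_AS:
  assumes m: "2 \<le> m" "m \<le> n" and n: "n \<in> P" and t: "t \<in> P" "t \<le> n" "{1..<t} \<inter> P = {}" "1 \<le> t"
  shows "card {\<pi> \<in> VF n P. \<pi> 1 = m} =
    (if m - 1 \<in> P \<or> m \<in> P then card (AS (unskip m t) (m - 2) (unskip m n) (unskip m ` P)) else 0)"
proof -
  have m1: "1 \<le> m" using m by simp
  have ut: "unskip m t \<le> unskip m n" using t(2) by (auto simp: unskip_def)
  have up: "{1..<unskip m t} \<inter> unskip m ` P = {}"
  proof -
    have False if p: "p \<in> P" "1 \<le> unskip m p" "unskip m p < unskip m t" for p
    proof -
      have "1 \<le> p" "p < t" using p by (auto simp: unskip_def split: if_splits)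
      then show False using p t by auto
    qed
    then show ?thesis by auto
  qed
  have "valley_free n P (ins m \<sigma>) \<longleftrightarrow> (m - 1 \<in> P \<or> m \<in> P) \<and> valley_free (unskip m n) (unskip m ` P) \<sigma> \<and>
     (strict_antimono_on {1..unskip m t} \<sigma> \<or> m - 2 < \<sigma> 1)" if s: "\<sigma> \<in> involutions (unskip m n)" for \<sigma>
    using valley_free_ins [OF m n t s] valley_free_first_block [OF s _ ut up m(1)] by blast
  from card_ins [of m n "valley_free n P" "\<lambda>\<sigma>. (m - 1 \<in> P \<or> m \<in> P) \<and>
     valley_free (unskip m n) (unskip m ` P) \<sigma> \<and> (strict_antimono_on {1..unskip m t} \<sigma> \<or> m - 2 < \<sigma> 1)",
     OF m1 m(2) this]
  show ?thesis by (simp add: VF_def AS_def conj_assoc)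
qed

text \<open>By \<open>t \<le> m\<close>, position \<open>m\<close> with its value 1 lies behind the
  first segment or at its end, where it cannot spoil the decrease. If \<open>unskip m t = 0\<close>,
  the first segment consists of the value \<open>m\<close> alone or of the values 2, 1, and is
  decreasing whatever \<sigma> is.\<close>

lemma antimono_ins:
  assumes m: "t \<le> m" "2 \<le> m" and t: "1 \<le> t" and s: "\<sigma> \<in> involutions n"
  shows "strict_antimono_on {1..t} (ins m \<sigma>) \<longleftrightarrow>
    strict_antimono_on {1..unskip m t} \<sigma> \<and> (unskip m t = 0 \<or> \<sigma> 1 \<le> m - 2)"
    (is "?l \<longleftrightarrow> ?r")
proof
  have m1: "1 \<le> m" using m by simp
  have sk: "skip m x \<in> {1..t} \<longleftrightarrow> x \<in> {1..unskip m t}" for x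
    using skip_le [OF m1, of x t] skip_eq_0 [of m x] by (auto simp: Suc_le_eq simp del: skip_eq_0)
  {
    assume l: ?l
    have "strict_antimono_on {1..unskip m t} \<sigma>"
    proof (rule monotone_onI)
      fix y z assume "y \<in> {1..unskip m t}" "z \<in> {1..unskip m t}" "y < z"
      then have "ins m \<sigma> (skip m z) < ins m \<sigma> (skip m y)"
        using l sk unfolding monotone_on_def by (metis skip_less)
      then show "\<sigma> z < \<sigma> y" using m1 by simp
    qed
    moreover have "\<sigma> 1 \<le> m - 2" if "unskip m t \<noteq> 0"
    proof -
      have "skip m 1 \<in> {1..t}" using sk that by auto
      moreover have "1 < skip m 1" by (auto simp: skip_def)
      moreover have "1 \<in> {1..t}" using t by simp
      ultimately have "ins m \<sigma> (skip m 1) < ins m \<sigma> 1"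
        using l unfolding monotone_on_def by blast
      then have "skip m (\<sigma> 1) < m" using m1 by simp
      then show ?thesis using m by (simp add: skip_less_m)
    qed
    ultimately show ?r by blast
  next
    assume r: ?r
    show ?l
    proof (rule monotone_onI)
      fix y z assume y: "y \<in> {1..t}" and z: "z \<in> {1..t}" and yz: "y < z"
      have "y \<noteq> m" "z \<noteq> 1" using m y z yz by auto
      show "ins m \<sigma> z < ins m \<sigma> y"
      proof (cases "z = m")
        case True
        have "ins m \<sigma> y \<noteq> 1" "ins m \<sigma> y \<noteq> 0"
        proof -
          have inv: "ins m \<sigma> y \<noteq> 1 \<and> ins m \<sigma> y \<noteq> 0" if "y = skip m x" for x
          proof -
            have "x \<noteq> 0" using that y skip_0(1) [of m] by (intro notI) simp
            then have "skip m (\<sigma> x) \<noteq> 0" using involutions_0 [OF s] by simp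
            then show ?thesis using that m1 skip_neq [OF m1] by simp
          qed
          have "ins m \<sigma> y \<noteq> 1 \<and> ins m \<sigma> y \<noteq> 0"
          proof (cases "y = 1")
            case True
            then show ?thesis using m m1 by simp
          next
            case False
            then show ?thesis using inv skip_cases [OF m1, of y] \<open>y \<noteq> m\<close> by blast
          qed
          then show "ins m \<sigma> y \<noteq> 1" "ins m \<sigma> y \<noteq> 0" by blast+
        qed
        then show ?thesis using True m1 by simp
      next
        case False
        then obtain z' where z': "z = skip m z'" using skip_cases [OF m1] \<open>z \<noteq> 1\<close> by metis
        then have zu: "z' \<in> {1..unskip m t}" using sk z by simp
        show ?thesis
        proof (cases "y = 1")
          case True
          have "1 \<in> {1..unskip m t}" using zu by auto
          then have "\<sigma> z' \<le> \<sigma> 1" using r zu unfolding monotone_on_def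
            by (metis atLeastAtMost_iff le_neq_implies_less less_imp_le_nat order_refl)
          also have "\<sigma> 1 \<le> m - 2" using r zu by auto
          finally have "skip m (\<sigma> z') < m" using m by (simp add: skip_less_m)
          then show ?thesis using z' True m1 by simp
        next
          case False
          then obtain y' where y': "y = skip m y'" using skip_cases [OF m1] \<open>y \<noteq> m\<close> by metis
          then have "y' \<in> {1..unskip m t}" using sk y by simp
          moreover have "y' < z'" using yz y' z' by simp
          ultimately have "\<sigma> z' < \<sigma> y'" using r zu unfolding monotone_on_def by blast
          then show ?thesis using y' z' m1 by simp
        qed
      qed
    qed
  }
qed

lemma card_DS:
  assumes m: "2 \<le> m" "m \<le> n" and n: "n \<in> P" and t: "t \<in> P" "t \<le> n" "{1..<t} \<inter> P = {}" "1 \<le> t"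
    and tm: "t \<le> m"
  shows "card {\<pi> \<in> VF n P. strict_antimono_on {1..t} \<pi> \<and> \<pi> 1 = m} =
    (if m - 1 \<in> P \<or> m \<in> P then card (DS (unskip m t) (m - 2) (unskip m n) (unskip m ` P)) else 0)"
proof -
  have m1: "1 \<le> m" using m by simp
  have "(valley_free n P (ins m \<sigma>) \<and> strict_antimono_on {1..t} (ins m \<sigma>)) \<longleftrightarrow> (m - 1 \<in> P \<or> m \<in> P) \<and>
     valley_free (unskip m n) (unskip m ` P) \<sigma> \<and> strict_antimono_on {1..unskip m t} \<sigma> \<and>
     (unskip m t = 0 \<or> \<sigma> 1 \<le> m - 2)" if s: "\<sigma> \<in> involutions (unskip m n)" for \<sigma>
  proof -
    \<comment> \<open>A decreasing first segment has no ascents, so the third condition of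
      \<open>valley_free_ins\<close> is vacuous.\<close>
    have "(\<forall>y z. 1 \<le> y \<and> y < z \<and> z \<le> unskip m t \<and> \<sigma> y < \<sigma> z \<longrightarrow> m \<le> Suc (\<sigma> y))"
      if "strict_antimono_on {1..unskip m t} \<sigma>"
    proof (intro allI impI)
      fix y z assume *: "1 \<le> y \<and> y < z \<and> z \<le> unskip m t \<and> \<sigma> y < \<sigma> z"
      then have "\<sigma> z < \<sigma> y" using that by (intro monotone_onD [OF that]) auto
      with * show "m \<le> Suc (\<sigma> y)" by simp
    qed
    then show ?thesis
      using valley_free_ins [OF m n t s] antimono_ins [OF tm m(1) t(4) s] by blast
  qed
  from card_ins [of m n "\<lambda>\<pi>. valley_free n P \<pi> \<and> strict_antimono_on {1..t} \<pi>" "\<lambda>\<sigma>. (m - 1 \<in> P \<or> m \<in> P) \<and>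
     valley_free (unskip m n) (unskip m ` P) \<sigma> \<and> strict_antimono_on {1..unskip m t} \<sigma> \<and>
     (unskip m t = 0 \<or> \<sigma> 1 \<le> m - 2)", OF m1 m(2) this]
  show ?thesis by (simp add: VF_def DS_def conj_assoc)
qed

section \<open>Segments of a composition\<close>

text \<open>The peak must be the position of the maximum; a descent before it or an ascent after it
  would form a valley with it.\<close>

lemma unimodal_between_iff:
  assumes "a \<le> b" and inj: "\<And>x y. \<pi> x = \<pi> y \<longleftrightarrow> x = y"
  shows "unimodal_between a b \<pi> \<longleftrightarrow>
    (\<forall>x y z. a \<le> x \<and> x < y \<and> y < z \<and> z \<le> b \<longrightarrow> \<not> (\<pi> y < \<pi> x \<and> \<pi> y < \<pi> z))"
    (is "?l \<longleftrightarrow> ?r")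
proof
  assume ?l
  then obtain c where c: "c \<in> {a..b}" "strict_mono_on {a..c} \<pi>" "strict_antimono_on {c..b} \<pi>"
    by (auto simp: unimodal_between_def)
  show ?r
  proof (intro allI impI notI)
    fix x y z assume *: "a \<le> x \<and> x < y \<and> y < z \<and> z \<le> b" and **: "\<pi> y < \<pi> x \<and> \<pi> y < \<pi> z"
    show False
    proof (cases "y \<le> c")
      case True
      then have "\<pi> x < \<pi> y" using * by (intro monotone_onD [OF c(2)]) auto
      then show False using ** by simp
    next
      case False
      then have "\<pi> z < \<pi> y" using * by (intro monotone_onD [OF c(3)]) auto
      then show False using ** by simp
    qed
  qed
next
  assume r: ?r
  have "Max (\<pi> ` {a..b}) \<in> \<pi> ` {a..b}" using assms(1) by (intro Max_in) auto
  then obtain c where c: "c \<in> {a..b}" "\<pi> c = Max (\<pi> ` {a..b})" by auto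
  then have le: "\<pi> x \<le> \<pi> c" if "x \<in> {a..b}" for x using that by auto
  have lt: "\<pi> x < \<pi> c" if "x \<in> {a..b}" "x \<noteq> c" for x
    using le [OF that(1)] inj that(2) by (metis le_neq_implies_less)
  have "strict_mono_on {a..c} \<pi>"
  proof (rule monotone_onI)
    fix x y assume xy: "x \<in> {a..c}" "y \<in> {a..c}" "x < y"
    show "\<pi> x < \<pi> y"
    proof (cases "y = c")
      case False
      then have "\<not> (\<pi> y < \<pi> x \<and> \<pi> y < \<pi> c)" using r xy c(1) by auto
      then have "\<pi> x \<le> \<pi> y" using lt [of y] xy False c(1) by auto
      then show ?thesis using inj xy(3) by (metis le_neq_implies_less nat_neq_iff)
    qed (use lt [of x] xy c(1) in auto)
  qed
  moreover have "strict_antimono_on {c..b} \<pi>"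
  proof (rule monotone_onI)
    fix x y assume xy: "x \<in> {c..b}" "y \<in> {c..b}" "x < y"
    show "\<pi> y < \<pi> x"
    proof (cases "x = c")
      case False
      then have "c < x" using xy by auto
      then have "\<not> (\<pi> x < \<pi> c \<and> \<pi> x < \<pi> y)"
        using r [rule_format, of c x y] xy c(1) by auto
      then have "\<pi> y \<le> \<pi> x" using lt [of x] xy False c(1) by auto
      then show ?thesis using inj xy(3) by (metis le_neq_implies_less nat_neq_iff)
    qed (use lt [of y] xy c(1) in auto)
  qed
  ultimately show ?l using c(1) by (auto simp: unimodal_between_def)
qed

section \<open>Partial sums and cut sets\<close>

lemma psum_0 [simp]: "psum l 0 = 0"
  by (simp add: psum_def)

lemma psum_Cons [simp]: "psum (x # l) (Suc i) = x + psum l i"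
  by (simp add: psum_def)

lemma psum_Nil [simp]: "psum [] i = 0"
  by (simp add: psum_def)

lemma psum_Suc: "i < length l \<Longrightarrow> psum l (Suc i) = psum l i + l ! i"
  by (simp add: psum_def take_Suc_conv_app_nth)

lemma psum_length: "length l \<le> i \<Longrightarrow> psum l i = sum_list l"
  by (simp add: psum_def)

lemma psum_mono: "i \<le> j \<Longrightarrow> psum l i \<le> psum l j"
proof (induction l arbitrary: i j)
  case (Cons x l)
  then show ?case by (cases i; cases j) auto
qed simp

lemma psum_le_sum_list: "psum l i \<le> sum_list l"
  using psum_mono [of i "max i (length l)" l] psum_length [of l "max i (length l)"] by simp

lemma psum_1: "l \<noteq> [] \<Longrightarrow> psum l (Suc 0) = l ! 0"
  by (cases l) auto

text \<open>\<open>psum l\<close> is constant from \<open>length l\<close> on, so the index needs no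
  bound. Being a set, the range does not record repeated sums; this is how parts 0 become
  invisible.\<close>

definition cuts :: "nat list \<Rightarrow> nat set" where
  "cuts l = range (psum l)"

lemma sum_list_cuts: "sum_list l \<in> cuts l"
  unfolding cuts_def using psum_length [of l "length l"] by (metis order_refl rangeI)

lemma block_exists:
  assumes "1 \<le> x" "x \<le> sum_list l"
  obtains i where "i < length l" "psum l i < x" "x \<le> psum l (Suc i)"
proof -
  define j where "j = (LEAST j. x \<le> psum l j)"
  have ex: "x \<le> psum l (length l)" using assms by (simp add: psum_length)
  have j: "x \<le> psum l j" unfolding j_def using ex by (rule LeastI)
  have "j \<le> length l" unfolding j_def using ex by (rule Least_le)
  moreover have "j \<noteq> 0" using j assms by (intro notI) simp
  then obtain i where i: "j = Suc i" by (metis not0_implies_Suc)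
  have "\<not> x \<le> psum l i" using i unfolding j_def by (metis lessI not_less_Least)
  then show ?thesis using that [of i] i j \<open>j \<le> length l\<close> by simp
qed

lemma cuts_between:
  assumes "psum l i < p" "p < psum l (Suc i)"
  shows "p \<notin> cuts l"
proof
  assume "p \<in> cuts l"
  then obtain j where "p = psum l j" by (auto simp: cuts_def)
  then show False using assms psum_mono [of j i l] psum_mono [of "Suc i" j l] by linarith
qed

text \<open>An interval without cuts lies in a single segment. Positive parts make every segment
  nonempty, as it must contain its peak.\<close>

lemma unimodal_perm_iff:
  assumes inj: "\<And>x y. \<pi> x = \<pi> y \<longleftrightarrow> x = y" and pos: "\<forall>p\<in>set l. 0 < p"
  shows "unimodal_perm l \<pi> \<longleftrightarrow> valley_free (sum_list l) (cuts l) \<pi>"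
proof -
  have ub: "unimodal_between (psum l i + 1) (psum l (i + 1)) \<pi> \<longleftrightarrow>
    (\<forall>x y z. psum l i < x \<and> x < y \<and> y < z \<and> z \<le> psum l (Suc i) \<longrightarrow> \<not> (\<pi> y < \<pi> x \<and> \<pi> y < \<pi> z))"
    if "i < length l" for i
    using unimodal_between_iff [of "psum l i + 1" "psum l (i + 1)", OF _ inj] that pos
    by (simp add: psum_Suc Suc_le_eq)
  have "unimodal_perm l \<pi> \<longleftrightarrow> (\<forall>i<length l. \<forall>x y z. psum l i < x \<and> x < y \<and> y < z \<and> z \<le> psum l (Suc i) \<longrightarrow>
    \<not> (\<pi> y < \<pi> x \<and> \<pi> y < \<pi> z))" (is "_ \<longleftrightarrow> ?u")
    unfolding unimodal_perm_def using ub by blast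
  also have "\<dots> \<longleftrightarrow> valley_free (sum_list l) (cuts l) \<pi>"
  proof
    assume u: ?u
    show "valley_free (sum_list l) (cuts l) \<pi>"
      unfolding valley_free_def
    proof (intro allI impI)
      fix x y z assume *: "1 \<le> x \<and> x < y \<and> y < z \<and> z \<le> sum_list l \<and> {x..<z} \<inter> cuts l = {}"
      then obtain i where i: "i < length l" "psum l i < x" "x \<le> psum l (Suc i)"
        using block_exists [of x l] by auto
      have "psum l (Suc i) \<notin> {x..<z}" using * by (auto simp: cuts_def)
      then have "z \<le> psum l (Suc i)" using i by auto
      then show "\<not> (\<pi> y < \<pi> x \<and> \<pi> y < \<pi> z)" using u i * by blast
    qed
  next
    assume v: "valley_free (sum_list l) (cuts l) \<pi>"
    show ?u
    proof (intro allI impI)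
      fix i x y z assume i: "i < length l" and *: "psum l i < x \<and> x < y \<and> y < z \<and> z \<le> psum l (Suc i)"
      have "{x..<z} \<inter> cuts l = {}" using * cuts_between [of l i] by (auto simp: disjoint_iff)
      moreover have "z \<le> sum_list l" using * psum_le_sum_list [of l "Suc i"] by linarith
      moreover have "1 \<le> x" using * by linarith
      ultimately show "\<not> (\<pi> y < \<pi> x \<and> \<pi> y < \<pi> z)" using v * unfolding valley_free_def by blast
    qed
  qed
  finally show ?thesis .
qed

lemma unimodal_invs_eq:
  assumes "\<forall>p\<in>set l. 0 < p"
  shows "unimodal_invs l = VF (sum_list l) (cuts l)"
proof -
  have "\<pi> \<in> unimodal_invs l \<longleftrightarrow> \<pi> \<in> VF (sum_list l) (cuts l)" for \<pi>
    using unimodal_perm_iff [OF _ assms, of \<pi>] involutions_inj [of \<pi> "sum_list l"]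
    by (auto simp: unimodal_invs_def VF_def involutions_def)
  then show ?thesis by blast
qed

lemma unimodal_invs_j_eq:
  assumes "\<forall>p\<in>set l. 0 < p"
  shows "unimodal_invs_j j l = AS (l ! 0) (psum l j) (sum_list l) (cuts l)"
  by (auto simp: unimodal_invs_j_def unimodal_invs_eq [OF assms] AS_def)

lemma decr_invs_eq:
  assumes "\<forall>p\<in>set l. 0 < p" "l \<noteq> []"
  shows "decr_invs j l = DS (l ! 0) (psum l j) (sum_list l) (cuts l)"
proof -
  have "l ! 0 \<noteq> 0" using assms by (cases l) auto
  then show ?thesis by (auto simp: decr_invs_def unimodal_invs_eq [OF assms(1)] DS_def)
qed

section \<open>Shortening the segments of positions 1 and m\<close>

definition dec :: "nat \<Rightarrow> nat list \<Rightarrow> nat list" where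
  "dec i l = l[i := l ! i - 1]"

lemma length_dec [simp]: "length (dec i l) = length l"
  by (simp add: dec_def)

lemma nth_dec: "j < length l \<Longrightarrow> dec i l ! j = (if i = j then l ! j - 1 else l ! j)"
  by (auto simp: dec_def nth_list_update)

lemma psum_dec:
  "i < length l \<Longrightarrow> 0 < l ! i \<Longrightarrow> psum (dec i l) j = (if i < j then psum l j - 1 else psum l j)"
proof (induction l arbitrary: i j)
  case (Cons x l)
  have "0 < psum l j" if "i < length l" "0 < l ! i" "i < j" for i j
    using psum_mono [of "Suc i" j l] that by (simp add: psum_Suc)
  then show ?case using Cons
    by (cases i; cases j) (auto simp: dec_def Suc_le_eq)
qed simp

text \<open>Deleting positions 1 and \<open>m\<close> shortens the first segment and the segment of
  \<open>m\<close>. For \<open>i = 0\<close> the first part loses 2, and \<open>2 \<le> m\<close>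
  makes it large enough for the truncated subtraction.\<close>

lemma unskip_psum:
  assumes l: "l \<noteq> []" "0 < l ! 0" and i: "i < length l" "psum l i < m" "m \<le> psum l (Suc i)" and m: "2 \<le> m"
  shows "unskip m (psum l j) = psum (dec i (dec 0 l)) j"
proof -
  have d0: "psum (dec 0 l) j = psum l j - 1" for j
    using psum_dec [of 0 l j] l by (cases j) auto
  have "0 < dec 0 l ! i"
  proof (cases "i = 0")
    case True
    then show ?thesis using i m l by (simp add: nth_dec psum_1)
  next
    case False
    then show ?thesis using i by (simp add: nth_dec psum_Suc)
  qed
  then have "psum (dec i (dec 0 l)) j = (if i < j then psum l j - 2 else psum l j - 1)"
    using psum_dec [of i "dec 0 l" j] i d0 by (simp add: numeral_2_eq_2)
  moreover have "m \<le> psum l j \<longleftrightarrow> i < j"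
    using psum_mono [of j i l] psum_mono [of "Suc i" j l] i by linarith
  ultimately show ?thesis using m by (auto simp: unskip_def)
qed

lemma unskip_1_psum:
  assumes l: "l \<noteq> []" "0 < l ! 0"
  shows "unskip 1 (psum l j) = psum (dec 0 l) j"
  using psum_dec [of 0 l j] l by (cases j) (auto simp: unskip_def)

text \<open>\<open>E\<close> stands for \<open>AS\<close> or \<open>DS\<close>, so that one argument
  serves both kinds of recurrences; the list may contain zeros.\<close>

definition ecard :: "(nat \<Rightarrow> nat \<Rightarrow> nat \<Rightarrow> nat set \<Rightarrow> (nat \<Rightarrow> nat) set) \<Rightarrow> nat \<Rightarrow> nat list \<Rightarrow> nat" where
  "ecard E j l = card (E (l ! 0) (psum l j) (sum_list l) (cuts l))"

lemma first_block_cut: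
  assumes "l \<noteq> []" "0 < l ! 0"
  shows "sum_list l \<in> cuts l" "l ! 0 \<in> cuts l" "l ! 0 \<le> sum_list l" "{1..<l ! 0} \<inter> cuts l = {}" "1 \<le> l ! 0"
proof -
  show "l ! 0 \<in> cuts l" unfolding cuts_def using psum_1 [OF assms(1)] by (metis rangeI)
  show "l ! 0 \<le> sum_list l" using psum_1 [OF assms(1)] psum_le_sum_list by metis
  show "{1..<l ! 0} \<inter> cuts l = {}" using cuts_between [of l 0] psum_1 [OF assms(1)] by (auto simp: disjoint_iff)
qed (use assms sum_list_cuts in auto)

lemma unskip_cuts:
  assumes l: "l \<noteq> []" "0 < l ! 0" and i: "i < length l" "psum l i < m" "m \<le> psum l (Suc i)" and m: "2 \<le> m"
  shows "unskip m ` cuts l = cuts (dec i (dec 0 l))" "unskip m (l ! 0) = dec i (dec 0 l) ! 0"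
    "unskip m (sum_list l) = sum_list (dec i (dec 0 l))"
    "m - 1 \<in> cuts l \<or> m \<in> cuts l \<longleftrightarrow> m = psum l i + 1 \<or> m = psum l (Suc i)"
proof -
  note u = unskip_psum [OF assms]
  show "unskip m ` cuts l = cuts (dec i (dec 0 l))" by (simp add: cuts_def image_image u)
  show "unskip m (l ! 0) = dec i (dec 0 l) ! 0"
    using u [of "Suc 0"] psum_1 [of l] psum_1 [of "dec i (dec 0 l)"] l by (metis length_0_conv length_dec)
  show "unskip m (sum_list l) = sum_list (dec i (dec 0 l))"
    using u [of "length l"] by (simp add: psum_length)
  have "m - 1 = psum l i" if "m - 1 \<in> cuts l"
    using cuts_between [of l i "m - 1"] that i by fastforce
  moreover have "m = psum l (Suc i)" if "m \<in> cuts l"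
    using cuts_between [of l i m] that i by fastforce
  ultimately show "m - 1 \<in> cuts l \<or> m \<in> cuts l \<longleftrightarrow> m = psum l i + 1 \<or> m = psum l (Suc i)"
    using m by (auto simp: cuts_def)
qed

text \<open>The threshold \<open>m - 2\<close> is a partial sum of the shortened list, of index
  \<open>Suc i\<close> if \<open>m\<close> is the last position of its segment and of index
  \<open>i\<close> if it is the first. Hence the two series with neighbouring indices in the
  recurrences.\<close>

lemma card_AS_block:
  assumes l: "l \<noteq> []" "0 < l ! 0" and i: "i < length l" "psum l i < m" "m \<le> psum l (Suc i)" and m: "2 \<le> m"
  shows "card {\<pi> \<in> VF (sum_list l) (cuts l). \<pi> 1 = m} =
    (if m = psum l (Suc i) then ecard AS (Suc i) (dec i (dec 0 l))
     else if m = psum l i + 1 then ecard AS i (dec i (dec 0 l)) else 0)"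
proof -
  have mn: "m \<le> sum_list l" using i psum_le_sum_list order.trans by metis
  have "psum (dec i (dec 0 l)) i = m - 2" if "m = psum l i + 1"
    using unskip_psum [OF assms, of i] that i m by (simp add: unskip_def)
  moreover have "psum (dec i (dec 0 l)) (Suc i) = m - 2" if "m = psum l (Suc i)"
    using unskip_psum [OF assms, of "Suc i"] that i m by (simp add: unskip_def)
  ultimately show ?thesis
    unfolding card_AS [OF m mn first_block_cut [OF l]] unskip_cuts [OF assms] ecard_def by auto
qed

lemma card_DS_block:
  assumes l: "l \<noteq> []" "0 < l ! 0" and i: "i < length l" "psum l i < m" "m \<le> psum l (Suc i)" and m: "2 \<le> m"
    and t: "l ! 0 \<le> m"
  shows "card {\<pi> \<in> VF (sum_list l) (cuts l). strict_antimono_on {1..l ! 0} \<pi> \<and> \<pi> 1 = m} =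
    (if m = psum l (Suc i) then ecard DS (Suc i) (dec i (dec 0 l))
     else if m = psum l i + 1 then ecard DS i (dec i (dec 0 l)) else 0)"
proof -
  have mn: "m \<le> sum_list l" using i psum_le_sum_list order.trans by metis
  have "psum (dec i (dec 0 l)) i = m - 2" if "m = psum l i + 1"
    using unskip_psum [OF l i m, of i] that i m by (simp add: unskip_def)
  moreover have "psum (dec i (dec 0 l)) (Suc i) = m - 2" if "m = psum l (Suc i)"
    using unskip_psum [OF l i m, of "Suc i"] that i m by (simp add: unskip_def)
  ultimately show ?thesis
    unfolding card_DS [OF m mn first_block_cut [OF l] t] unskip_cuts [OF l i m] ecard_def by auto
qed

text \<open>The two summands count the involutions with \<open>\<pi> 1\<close> the last and the first position of a segment.\<close>

definition block_sum :: "(nat \<Rightarrow> nat \<Rightarrow> nat \<Rightarrow> nat set \<Rightarrow> (nat \<Rightarrow> nat) set) \<Rightarrow> nat list \<Rightarrow> nat \<Rightarrow> nat" where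
  "block_sum E l i = ecard E (Suc i) (dec i (dec 0 l)) + (if 2 \<le> l ! i then ecard E i (dec i (dec 0 l)) else 0)"

section \<open>Counting by the segment that contains the first value\<close>

lemma card_Collect_disj:
  assumes "finite V" "\<And>x. \<not> (R x \<and> S x)"
  shows "card {x \<in> V. R x \<or> S x} = card {x \<in> V. R x} + card {x \<in> V. S x}"
proof -
  have "{x \<in> V. R x \<or> S x} = {x \<in> V. R x} \<union> {x \<in> V. S x}" by blast
  moreover have "{x \<in> V. R x} \<inter> {x \<in> V. S x} = {}" using assms(2) by blast
  ultimately show ?thesis using assms(1) by (simp add: card_Un_disjoint)
qed

lemma card_split_first:
  fixes V :: "(nat \<Rightarrow> nat) set"
  assumes "finite V"
  shows "card {\<pi> \<in> V. R \<pi> \<and> a < \<pi> 1 \<and> \<pi> 1 \<le> b} = (\<Sum>m\<in>{a<..b}. card {\<pi> \<in> V. R \<pi> \<and> \<pi> 1 = m})"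
proof -
  have "{\<pi> \<in> V. R \<pi> \<and> a < \<pi> 1 \<and> \<pi> 1 \<le> b} = (\<Union>m\<in>{a<..b}. {\<pi> \<in> V. R \<pi> \<and> \<pi> 1 = m})" by auto
  also have "card \<dots> = (\<Sum>m\<in>{a<..b}. card {\<pi> \<in> V. R \<pi> \<and> \<pi> 1 = m})"
    using assms by (intro card_UN_disjoint) auto
  finally show ?thesis .
qed

text \<open>In a segment of length 1 the first and the last position coincide and are counted once,
  hence the condition \<open>a + 2 \<le> b\<close>.\<close>

lemma sum_ends:
  fixes f :: "nat \<Rightarrow> nat"
  assumes "a < b" "\<And>m. a < m \<Longrightarrow> m \<le> b \<Longrightarrow> f m = (if m = b then v else if m = a + 1 then u else 0)"
  shows "sum f {a<..b} = v + (if a + 2 \<le> b then u else 0)"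
proof -
  have "sum f {a<..b} = sum f {b, a + 1}"
    using assms by (intro sum.mono_neutral_right) auto
  also have "\<dots> = v + (if a + 2 \<le> b then u else 0)"
    using assms(1) assms(2) [of b] assms(2) [of "a + 1"] by (cases "b = a + 1") auto
  finally show ?thesis .
qed

lemma card_block:
  assumes l: "l \<noteq> []" "0 < l ! 0" and i: "1 \<le> i" "i < length l" "0 < l ! i"
  shows "card {\<pi> \<in> VF (sum_list l) (cuts l). psum l i < \<pi> 1 \<and> \<pi> 1 \<le> psum l (Suc i)} = block_sum AS l i"
    and "card {\<pi> \<in> VF (sum_list l) (cuts l). strict_antimono_on {1..l ! 0} \<pi> \<and> psum l i < \<pi> 1 \<and> \<pi> 1 \<le> psum l (Suc i)} = block_sum DS l i"
proof -
  have p: "l ! 0 \<le> psum l i" using psum_mono [of "Suc 0" i l] i psum_1 [OF l(1)] by simp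
  then have m: "2 \<le> m" "l ! 0 \<le> m" if "psum l i < m" for m using l that by auto
  have lt: "psum l i < psum l (Suc i)" "psum l i + 2 \<le> psum l (Suc i) \<longleftrightarrow> 2 \<le> l ! i"
    using i by (auto simp: psum_Suc)
  show "card {\<pi> \<in> VF (sum_list l) (cuts l). psum l i < \<pi> 1 \<and> \<pi> 1 \<le> psum l (Suc i)} = block_sum AS l i"
    using card_split_first [of "VF (sum_list l) (cuts l)" "\<lambda>_. True" "psum l i" "psum l (Suc i)"]
      sum_ends [OF lt(1) card_AS_block [OF l i(2) _ _ m(1)]] lt(2)
    by (simp add: block_sum_def)
  show "card {\<pi> \<in> VF (sum_list l) (cuts l). strict_antimono_on {1..l ! 0} \<pi> \<and> psum l i < \<pi> 1 \<and> \<pi> 1 \<le> psum l (Suc i)} = block_sum DS l i"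
    using card_split_first [of "VF (sum_list l) (cuts l)" "\<lambda>\<pi>. strict_antimono_on {1..l ! 0} \<pi>" "psum l i" "psum l (Suc i)"]
      sum_ends [OF lt(1) card_DS_block [OF l i(2) _ _ m(1) m(2)]] lt(2)
    by (simp add: block_sum_def)
qed

lemma card_first_block:
  assumes l: "l \<noteq> []" "0 < l ! 0"
  shows "card {\<pi> \<in> VF (sum_list l) (cuts l). \<pi> 1 \<le> l ! 0} =
    card (VF (sum_list (dec 0 l)) (cuts (dec 0 l))) + (if 2 \<le> l ! 0 then ecard AS 1 (dec 0 (dec 0 l)) else 0)"
proof -
  let ?V = "VF (sum_list l) (cuts l)"
  let ?f = "\<lambda>m. card {\<pi> \<in> ?V. \<pi> 1 = m}"
  have n: "1 \<le> sum_list l" using first_block_cut(3,5) [OF l] by linarith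
  have V: "{\<pi> \<in> ?V. \<pi> 1 \<le> l ! 0} = {\<pi> \<in> ?V. True \<and> 0 < \<pi> 1 \<and> \<pi> 1 \<le> l ! 0}"
    using involutions_0 [of _ "sum_list l" 1] by (auto simp: VF_def)
  have u1: "unskip 1 (sum_list l) = sum_list (dec 0 l)" "unskip 1 ` cuts l = cuts (dec 0 l)"
    using unskip_1_psum [OF l, of "length l"] unskip_1_psum [OF l]
    by (simp_all add: psum_length cuts_def image_image)
  have f1: "?f 1 = card (VF (sum_list (dec 0 l)) (cuts (dec 0 l)))"
    using card_fix [OF n, of "cuts l"] u1 by simp
  \<comment> \<open>The first position of this segment is 1, which \<open>2 \<le> m\<close>
    excludes; only its last position remains.\<close>
  have f2: "?f m = (if m = l ! 0 then ecard AS 1 (dec 0 (dec 0 l)) else 0)" if "2 \<le> m" "m \<le> l ! 0" for m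
    using card_AS_block [OF l, of 0 m] that l psum_1 [of l] by simp
  have "card {\<pi> \<in> ?V. \<pi> 1 \<le> l ! 0} = sum ?f {0<..l ! 0}"
    unfolding V by (subst card_split_first) auto
  also have "\<dots> = sum ?f (insert 1 {1<..l ! 0})"
    using l by (intro sum.cong) auto
  also have "\<dots> = ?f 1 + sum ?f {1<..l ! 0}" by simp
  also have "sum ?f {1<..l ! 0} = (if 2 \<le> l ! 0 then ecard AS 1 (dec 0 (dec 0 l)) else 0)"
  proof (cases "2 \<le> l ! 0")
    case True
    then show ?thesis
      using sum_ends [of 1 "l ! 0" ?f "ecard AS 1 (dec 0 (dec 0 l))" 0] f2 by simp
  qed simp
  finally show ?thesis using f1 by simp
qed

lemma card_blocks:
  assumes l: "l \<noteq> []" "\<forall>p\<in>set l. 0 < p" and j: "1 \<le> j" "j \<le> k" "k \<le> length l"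
  shows "card {\<pi> \<in> VF (sum_list l) (cuts l). psum l j < \<pi> 1 \<and> \<pi> 1 \<le> psum l k} = (\<Sum>i=j..<k. block_sum AS l i)"
  using j(2,3)
proof (induction k rule: dec_induct)
  case base
  have "{\<pi> \<in> VF (sum_list l) (cuts l). psum l j < \<pi> 1 \<and> \<pi> 1 \<le> psum l j} = {}" by auto
  then show ?case by (simp only:) simp
next
  case (step k)
  let ?V = "VF (sum_list l) (cuts l)"
  have pos: "0 < l ! i" if "i < length l" for i using l that by simp
  have "psum l j < x \<and> x \<le> psum l (Suc k) \<longleftrightarrow>
    psum l j < x \<and> x \<le> psum l k \<or> psum l k < x \<and> x \<le> psum l (Suc k)" for x
    using psum_mono [OF step.hyps(1), of l] psum_mono [of k "Suc k" l] by linarith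
  then have "card {\<pi> \<in> ?V. psum l j < \<pi> 1 \<and> \<pi> 1 \<le> psum l (Suc k)} =
    card {\<pi> \<in> ?V. psum l j < \<pi> 1 \<and> \<pi> 1 \<le> psum l k \<or> psum l k < \<pi> 1 \<and> \<pi> 1 \<le> psum l (Suc k)}"
    by presburger
  also have "\<dots> = card {\<pi> \<in> ?V. psum l j < \<pi> 1 \<and> \<pi> 1 \<le> psum l k} +
    card {\<pi> \<in> ?V. psum l k < \<pi> 1 \<and> \<pi> 1 \<le> psum l (Suc k)}"
    by (rule card_Collect_disj) auto
  also have "card {\<pi> \<in> ?V. psum l j < \<pi> 1 \<and> \<pi> 1 \<le> psum l k} = (\<Sum>i=j..<k. block_sum AS l i)"
    by (rule step.IH) (use step.prems in linarith)
  also have "card {\<pi> \<in> ?V. psum l k < \<pi> 1 \<and> \<pi> 1 \<le> psum l (Suc k)} = block_sum AS l k"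
    using step j l pos by (intro card_block(1)) auto
  finally show ?case by (simp only: sum.atLeastLessThan_Suc [OF step.hyps(1)])
qed

lemma VF_first_le: "\<pi> \<in> VF (sum_list l) (cuts l) \<Longrightarrow> l \<noteq> [] \<Longrightarrow> 0 < l ! 0 \<Longrightarrow> \<pi> 1 \<le> sum_list l"
  using first_block_cut(3,5) [of l] involutions_in [of \<pi> "sum_list l" 1] by (auto simp: VF_def)

lemma card_unimodal_invs:
  assumes l: "l \<noteq> []" "\<forall>p\<in>set l. 0 < p"
  shows "card (unimodal_invs l) = card (VF (sum_list (dec 0 l)) (cuts (dec 0 l))) +
    (if 2 \<le> l ! 0 then ecard AS 1 (dec 0 (dec 0 l)) else 0) + (\<Sum>i=1..<length l. block_sum AS l i)"
proof -
  let ?V = "VF (sum_list l) (cuts l)"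
  have l0: "0 < l ! 0" using l by simp
  have k: "1 \<le> length l" using l(1) by (simp add: Suc_le_eq)
  have "card (unimodal_invs l) = card {\<pi> \<in> ?V. \<pi> 1 \<le> l ! 0 \<or> psum l 1 < \<pi> 1 \<and> \<pi> 1 \<le> psum l (length l)}"
    using VF_first_le [OF _ l(1) l0] psum_1 [OF l(1)] unimodal_invs_eq [OF l(2)]
    by (intro arg_cong [of _ _ card]) (auto simp: psum_length)
  also have "\<dots> = card {\<pi> \<in> ?V. \<pi> 1 \<le> l ! 0} + card {\<pi> \<in> ?V. psum l 1 < \<pi> 1 \<and> \<pi> 1 \<le> psum l (length l)}"
    by (rule card_Collect_disj) (use psum_1 [OF l(1)] in auto)
  finally show ?thesis
    by (simp only: card_first_block [OF l(1) l0] card_blocks [OF l order_refl k order_refl])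
qed

text \<open>Beyond the threshold the first segment need not decrease, so the later segments
  contribute as they do for all unimodal involutions.\<close>

lemma card_unimodal_invs_j:
  assumes l: "l \<noteq> []" "\<forall>p\<in>set l. 0 < p" and j: "1 \<le> j" "j \<le> length l"
  shows "card (unimodal_invs_j j l) = card (decr_invs j l) + (\<Sum>i=j..<length l. block_sum AS l i)"
proof -
  let ?V = "VF (sum_list l) (cuts l)"
  have l0: "0 < l ! 0" using l by simp
  let ?R = "\<lambda>\<pi>. \<pi> 1 \<le> psum l j \<and> strict_antimono_on {1..l ! 0} \<pi>"
  have "card (unimodal_invs_j j l) = card {\<pi> \<in> ?V. ?R \<pi> \<or> psum l j < \<pi> 1 \<and> \<pi> 1 \<le> psum l (length l)}"
    using VF_first_le [OF _ l(1) l0] unimodal_invs_eq [OF l(2)]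
    by (intro arg_cong [of _ _ card]) (auto simp: psum_length unimodal_invs_j_def)
  also have "\<dots> = card {\<pi> \<in> ?V. ?R \<pi>} + card {\<pi> \<in> ?V. psum l j < \<pi> 1 \<and> \<pi> 1 \<le> psum l (length l)}"
    by (rule card_Collect_disj) auto
  finally show ?thesis
    by (simp only: card_blocks [OF l j order_refl] decr_invs_def unimodal_invs_eq [OF l(2)])
qed

lemma card_decr_invs_Suc:
  assumes l: "l \<noteq> []" "\<forall>p\<in>set l. 0 < p" and j: "1 \<le> i" "i < length l"
  shows "card (decr_invs (Suc i) l) = card (decr_invs i l) + block_sum DS l i"
proof -
  let ?V = "VF (sum_list l) (cuts l)"
  have l0: "0 < l ! 0" "0 < l ! i" using l j by simp_all
  let ?R = "\<lambda>\<pi>. \<pi> 1 \<le> psum l i \<and> strict_antimono_on {1..l ! 0} \<pi>"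
  let ?S = "\<lambda>\<pi>. strict_antimono_on {1..l ! 0} \<pi> \<and> psum l i < \<pi> 1 \<and> \<pi> 1 \<le> psum l (Suc i)"
  have "card (decr_invs (Suc i) l) = card {\<pi> \<in> ?V. ?R \<pi> \<or> ?S \<pi>}"
    using unimodal_invs_eq [OF l(2)] psum_mono [of i "Suc i" l]
    by (intro arg_cong [of _ _ card]) (auto simp: decr_invs_def)
  also have "\<dots> = card {\<pi> \<in> ?V. ?R \<pi>} + card {\<pi> \<in> ?V. ?S \<pi>}"
    by (rule card_Collect_disj) auto
  finally show ?thesis
    by (simp only: card_block(2) [OF l(1) l0(1) j l0(2)] decr_invs_def unimodal_invs_eq [OF l(2)])
qed

section \<open>Decreasing first segments that are mapped to themselves\<close>

lemma antimono_first_ge: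
  assumes "strict_antimono_on {1..t} \<pi>" "\<pi> \<in> involutions n" "1 \<le> t"
  shows "t \<le> \<pi> (1::nat)"
proof -
  \<comment> \<open>These are \<open>t\<close> distinct positive values, none of them above \<pi>
    1.\<close>
  have "\<pi> ` {1..t} \<subseteq> {1..\<pi> 1}"
  proof
    fix y assume "y \<in> \<pi> ` {1..t}"
    then obtain x where x: "x \<in> {1..t}" "y = \<pi> x" by auto
    have "\<pi> x \<noteq> 0" using involutions_0 [OF assms(2), of x] x by simp
    moreover have "\<pi> x \<le> \<pi> 1"
    proof (cases "x = 1")
      case False
      then have "\<pi> x < \<pi> 1" using x assms(3) by (intro monotone_onD [OF assms(1)]) auto
      then show ?thesis by simp
    qed simp
    ultimately show "y \<in> {1..\<pi> 1}" using x by simp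
  qed
  then have "card (\<pi> ` {1..t}) \<le> card {1..\<pi> 1}" by (intro card_mono) auto
  moreover have "card (\<pi> ` {1..t}) = card {1..t}"
    using involutions_inj [OF assms(2)] by (intro card_image) (auto simp: inj_on_def)
  ultimately show ?thesis by simp
qed

lemma cuts_Cons_0: "cuts (0 # l) = cuts l"
proof -
  have "psum (0 # l) i \<in> cuts l" for i
    by (cases i) (auto simp: cuts_def intro: range_eqI [of _ _ 0])
  moreover have "psum l i \<in> cuts (0 # l)" for i
    by (auto simp: cuts_def intro: range_eqI [of _ _ "Suc i"])
  ultimately show ?thesis by (auto simp: cuts_def)
qed

text \<open>A decreasing first segment that \<open>\<pi>\<close> maps to itself is reversed by \<open>\<pi>\<close>; the outermost cycle
  \<open>(1 t)\<close> is removed repeatedly.\<close>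

lemma card_DS_first: "ecard DS 1 (t # l) = card (VF (sum_list l) (cuts l))"
proof (induction t rule: less_induct)
  case (less t)
  let ?l = "t # l"
  let ?V = "VF (sum_list ?l) (cuts ?l)"
  consider "t = 0" | "t = 1" | "2 \<le> t" by linarith
  then show ?case
  proof cases
    case 1
    then show ?thesis by (simp add: ecard_def DS_0 cuts_Cons_0)
  next
    case 2
    have "\<pi> 1 \<noteq> 0" if "\<pi> \<in> ?V" for \<pi>
      using involutions_0 [of \<pi> "sum_list ?l" 1] that by (simp add: VF_def)
    then have "DS (?l ! 0) (psum ?l 1) (sum_list ?l) (cuts ?l) = {\<pi> \<in> ?V. \<pi> 1 = 1}"
      using 2 by (fastforce simp: DS_def monotone_on_def le_Suc_eq)
    then have "ecard DS 1 ?l = card {\<pi> \<in> ?V. \<pi> 1 = 1}" by (simp add: ecard_def)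
    also have "\<dots> = card (VF (unskip 1 (sum_list ?l)) (unskip 1 ` cuts ?l))"
      using 2 by (intro card_fix) simp
    also have "unskip 1 ` cuts ?l = cuts (0 # l)"
      using unskip_1_psum [of ?l] 2 by (simp add: cuts_def image_image dec_def)
    finally show ?thesis using 2 by (simp add: cuts_Cons_0 unskip_def)
  next
    case 3
    have "\<pi> 1 = t" if "\<pi> \<in> ?V" "strict_antimono_on {1..t} \<pi>" "\<pi> 1 \<le> t" for \<pi>
      using antimono_first_ge [OF that(2)] that 3 by (auto simp: VF_def intro: order_antisym)
    then have "DS (?l ! 0) (psum ?l 1) (sum_list ?l) (cuts ?l) =
      {\<pi> \<in> ?V. strict_antimono_on {1..?l ! 0} \<pi> \<and> \<pi> 1 = t}"
      using 3 by (auto simp: DS_def)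
    then have "ecard DS 1 ?l = card {\<pi> \<in> ?V. strict_antimono_on {1..?l ! 0} \<pi> \<and> \<pi> 1 = t}"
      by (simp add: ecard_def)
    also have "\<dots> = ecard DS (Suc 0) (dec 0 (dec 0 ?l))"
      using 3 by (subst card_DS_block [where i = 0]) auto
    also have "dec 0 (dec 0 ?l) = (t - 2) # l" by (simp add: dec_def)
    finally show ?thesis using less.IH [of "t - 2"] 3 by simp
  qed
qed

section \<open>Coefficients of the series\<close>

definition vec :: "nat \<Rightarrow> (nat \<Rightarrow>\<^sub>0 nat) \<Rightarrow> nat list" where
  "vec k m = map (Poly_Mapping.lookup m) [1..<Suc k]"

text \<open>In contrast to \<open>comp_series\<close>, the parts of the exponent vectors may be 0.\<close>

definition ser :: "nat \<Rightarrow> (nat list \<Rightarrow> int) \<Rightarrow> int mps" where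
  "ser k c = Abs_mps (\<lambda>m. if Poly_Mapping.keys m \<subseteq> {1..k} then c (vec k m) else 0)"

lemma coeff_ser: "mps_coeff (ser k c) m = (if Poly_Mapping.keys m \<subseteq> {1..k} then c (vec k m) else 0)"
  by (simp add: ser_def Abs_mps_inverse)

lemma length_vec [simp]: "length (vec k m) = k"
  by (simp add: vec_def)

lemma nth_vec: "i < k \<Longrightarrow> vec k m ! i = Poly_Mapping.lookup m (Suc i)"
  by (simp add: vec_def del: upt_Suc)

lemma ser_cong: "(\<And>l. length l = k \<Longrightarrow> c l = d l) \<Longrightarrow> ser k c = ser k d"
  by (rule mps_eqI) (simp add: coeff_ser)

lemma ser_add: "ser k c + ser k d = ser k (\<lambda>l. c l + d l)"
  by (rule mps_eqI) (simp add: coeff_ser plus_mps.rep_eq)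

lemma ser_sum: "finite A \<Longrightarrow> (\<Sum>i\<in>A. ser k (c i)) = ser k (\<lambda>l. \<Sum>i\<in>A. c i l)"
proof (induction A rule: finite_induct)
  case empty
  show ?case by (rule mps_eqI) (simp add: coeff_ser zero_mps.rep_eq)
qed (simp add: ser_add)

text \<open>\<open>vec\<close> and \<open>comp_monom\<close> are mutually inverse between exponent
  vectors supported in \<open>{1..k}\<close> and lists of length \<open>k\<close>, so coefficients
  can be indexed by lists.\<close>

lemma comp_monom_eq_iff:
  "comp_monom l = m \<longleftrightarrow> Poly_Mapping.keys m \<subseteq> {1..length l} \<and> vec (length l) m = l"
proof
  have 0: "Poly_Mapping.lookup (comp_monom l) 0 = 0"
    by (simp add: comp_monom_def lookup_sum lookup_single)
  {
    assume "comp_monom l = m"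
    then have m: "Poly_Mapping.lookup m = Poly_Mapping.lookup (comp_monom l)" by simp
    have "i \<in> {1..length l}" if "i \<in> Poly_Mapping.keys m" for i
      using that m 0 lookup_comp_monom [of l "i - 1"] by (cases i) (auto simp: in_keys_iff split: if_splits)
    moreover have "vec (length l) m = l"
      by (rule nth_equalityI) (simp_all add: nth_vec m lookup_comp_monom)
    ultimately show "Poly_Mapping.keys m \<subseteq> {1..length l} \<and> vec (length l) m = l" by blast
  next
    assume a: "Poly_Mapping.keys m \<subseteq> {1..length l} \<and> vec (length l) m = l"
    show "comp_monom l = m"
    proof (rule poly_mapping_eqI)
      fix i
      show "Poly_Mapping.lookup (comp_monom l) i = Poly_Mapping.lookup m i"
      proof (cases i)
        case 0
        then show ?thesis using a \<open>Poly_Mapping.lookup (comp_monom l) 0 = 0\<close> by (auto simp: in_keys_iff)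
      next
        case (Suc j)
        have "Poly_Mapping.lookup m (Suc j) = 0" if "\<not> j < length l"
          using a that by (auto simp: in_keys_iff)
        moreover have "Poly_Mapping.lookup m (Suc j) = l ! j" if "j < length l"
          using a nth_vec [OF that, of m] by simp
        ultimately show ?thesis using Suc by (simp add: lookup_comp_monom)
      qed
    qed
  }
qed

text \<open>Positivity of the parts moves from the index set into the coefficient. Shifted and
  hatted series then share the form \<open>ser k\<close>, and an identity of series becomes one
  about a single list.\<close>

lemma comp_series_eq_ser:
  "comp_series k c = ser k (\<lambda>l. if \<forall>p\<in>set l. 0 < p then int (c l) else 0)"
proof (rule mps_eqI)
  fix m
  have eq: "{l. l \<in> compositions k \<and> comp_monom l = m} =
    (if Poly_Mapping.keys m \<subseteq> {1..k} \<and> (\<forall>p\<in>set (vec k m). 0 < p) then {vec k m} else {})"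
    by (auto simp: compositions_def comp_monom_eq_iff)
  show "mps_coeff (comp_series k c) m = mps_coeff (ser k (\<lambda>l. if \<forall>p\<in>set l. 0 < p then int (c l) else 0)) m"
    by (auto simp: coeff_ser comp_series_def Abs_mps_inverse eq)
qed

text \<open>The guard expresses divisibility by the variable, which the truncated subtraction in
  \<open>dec\<close> would hide.\<close>

lemma X_times_ser:
  assumes "i < k"
  shows "X (Suc i) * ser k c = ser k (\<lambda>l. if 0 < l ! i then c (dec i l) else 0)"
proof (rule mps_eqI)
  fix m
  let ?s = "Poly_Mapping.single (Suc i) (1::nat)"
  have ex: "(\<exists>b. m = ?s + b) \<longleftrightarrow> 0 < Poly_Mapping.lookup m (Suc i)"
  proof
    assume "\<exists>b. m = ?s + b"
    then show "0 < Poly_Mapping.lookup m (Suc i)" by (auto simp: lookup_add)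
  next
    assume "0 < Poly_Mapping.lookup m (Suc i)"
    then have "m = ?s + (m - ?s)"
      by (intro poly_mapping_eqI) (auto simp: lookup_add lookup_minus lookup_single when_def)
    then show "\<exists>b. m = ?s + b" by blast
  qed
  have keys: "Poly_Mapping.keys (m - ?s) \<subseteq> {1..k} \<longleftrightarrow> Poly_Mapping.keys m \<subseteq> {1..k}"
  proof -
    have "j \<in> Poly_Mapping.keys (m - ?s) \<longleftrightarrow> j \<in> Poly_Mapping.keys m" if "j \<notin> {1..k}" for j
      using that assms by (auto simp: in_keys_iff lookup_minus lookup_single when_def)
    then show ?thesis by blast
  qed
  have vec: "vec k (m - ?s) = dec i (vec k m)"
    by (rule nth_equalityI) (auto simp: nth_vec nth_dec lookup_minus lookup_single when_def)
  show "mps_coeff (X (Suc i) * ser k c) m = mps_coeff (ser k (\<lambda>l. if 0 < l ! i then c (dec i l) else 0)) m"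
    unfolding X_def coeff_monom_times ex by (simp add: coeff_ser keys [simplified] vec [simplified] nth_vec assms)
qed

lemma map_nth_filter:
  "map (\<lambda>i. l ! (i - 1)) (filter (\<lambda>i. i \<notin> R) [1..<Suc (length l)]) = nths l {i. Suc i \<notin> R}"
proof (induction l rule: rev_induct)
  case (snoc x l)
  have "map (\<lambda>i. (l @ [x]) ! (i - 1)) (filter (\<lambda>i. i \<notin> R) [1..<Suc (length l)]) =
    map (\<lambda>i. l ! (i - 1)) (filter (\<lambda>i. i \<notin> R) [1..<Suc (length l)])"
    by (rule map_cong) (auto simp: nth_append)
  then have "map (\<lambda>i. (l @ [x]) ! (i - 1)) (filter (\<lambda>i. i \<notin> R) [1..<Suc (length l)]) = nths l {i. Suc i \<notin> R}"
    using snoc.IH by (rule trans)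
  moreover have "[1..<Suc (length (l @ [x]))] = [1..<Suc (length l)] @ [Suc (length l)]" by simp
  ultimately show ?case by (simp add: nths_append del: upt_Suc)
qed simp

text \<open>Renaming is injective on monomials in the variables of the smaller series, so each
  coefficient is a sum of at most one term, which is absent if a deleted variable occurs.
  \<open>Z\<close> consists of list positions, counted from 0; the deleted variables are their
  successors.\<close>

lemma hat_ser:
  assumes Z: "Z \<subseteq> {..<k}"
  shows "hat k (Suc ` Z) (ser (k - card Z) c) =
    ser k (\<lambda>l. if \<forall>i\<in>Z. l ! i = 0 then c (nths l (- Z)) else 0)"
proof (rule mps_eqI)
  fix m
  define ys where "ys = filter (\<lambda>i. i \<notin> Suc ` Z) [1..<Suc k]"
  have set_ys: "set ys = {1..k} - Suc ` Z" unfolding ys_def by auto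
  have dist: "distinct ys" unfolding ys_def by simp
  have "card (set ys) = k - card Z"
    unfolding set_ys using Z by (subst card_Diff_subset) (auto simp: card_image finite_subset)
  then have len: "length ys = k - card Z" using distinct_card [OF dist] by simp
  have lk: "Poly_Mapping.lookup (rename_monom ys n) j =
    (\<Sum>a<length ys. Poly_Mapping.lookup n (Suc a) when ys ! a = j)" for n j
    by (simp add: rename_monom_def lookup_sum lookup_single)
  have lk1: "Poly_Mapping.lookup (rename_monom ys n) (ys ! a) = Poly_Mapping.lookup n (Suc a)"
    if "a < length ys" for n a
  proof -
    have "(Poly_Mapping.lookup n (Suc b) when ys ! b = ys ! a) = (if b = a then Poly_Mapping.lookup n (Suc b) else 0)"
      if "b < length ys" for b
      using dist \<open>a < length ys\<close> that by (simp add: nth_eq_iff_index_eq when_def)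
    then show ?thesis using that by (simp add: lk)
  qed
  have lk0: "Poly_Mapping.lookup (rename_monom ys n) j = 0" if "j \<notin> set ys" for n j
    unfolding lk using that by (intro sum.neutral) (auto simp: when_def)
  have ren: "rename_monom ys n = m \<longleftrightarrow> Poly_Mapping.keys m \<subseteq> set ys \<and> vec (length ys) n = map (Poly_Mapping.lookup m) ys" for n
  proof
    assume "rename_monom ys n = m"
    then have "Poly_Mapping.lookup (rename_monom ys n) = Poly_Mapping.lookup m" by simp
    then show "Poly_Mapping.keys m \<subseteq> set ys \<and> vec (length ys) n = map (Poly_Mapping.lookup m) ys"
      using lk0 lk1 by (auto simp: in_keys_iff nth_vec intro!: nth_equalityI)
  next
    assume *: "Poly_Mapping.keys m \<subseteq> set ys \<and> vec (length ys) n = map (Poly_Mapping.lookup m) ys"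
    show "rename_monom ys n = m"
    proof (rule poly_mapping_eqI)
      fix j
      show "Poly_Mapping.lookup (rename_monom ys n) j = Poly_Mapping.lookup m j"
      proof (cases "j \<in> set ys")
        case True
        then obtain a where a: "a < length ys" "j = ys ! a" by (metis in_set_conv_nth)
        then show ?thesis using * lk1 nth_vec [OF a(1), of n] by simp
      next
        case False
        then show ?thesis using * lk0 by (auto simp: in_keys_iff)
      qed
    qed
  qed
  let ?l = "map (Poly_Mapping.lookup m) ys"
  have S: "{n. Poly_Mapping.keys n \<subseteq> {1..length ys} \<and> rename_monom ys n = m} =
    (if Poly_Mapping.keys m \<subseteq> set ys then {comp_monom ?l} else {})"
  proof -
    have "Poly_Mapping.keys n \<subseteq> {1..length ys} \<and> vec (length ys) n = ?l \<longleftrightarrow> n = comp_monom ?l" for n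
      using comp_monom_eq_iff [of ?l n] by auto
    then show ?thesis unfolding ren by auto
  qed
  have keys: "Poly_Mapping.keys m \<subseteq> set ys \<longleftrightarrow> Poly_Mapping.keys m \<subseteq> {1..k} \<and> (\<forall>i\<in>Z. vec k m ! i = 0)"
    using Z unfolding set_ys by (auto simp: nth_vec in_keys_iff subset_iff)
  have l: "?l = nths (vec k m) (- Z)"
  proof -
    have "?l = map (\<lambda>i. vec k m ! (i - 1)) ys"
      by (rule map_cong) (auto simp: set_ys nth_vec)
    also have "\<dots> = nths (vec k m) {i. Suc i \<notin> Suc ` Z}"
      unfolding ys_def using map_nth_filter [of "vec k m" "Suc ` Z"] by simp
    also have "{i. Suc i \<notin> Suc ` Z} = - Z" by auto
    finally show ?thesis .
  qed
  have "mps_coeff (hat k (Suc ` Z) (ser (k - card Z) c)) m =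
    (\<Sum>n | Poly_Mapping.keys n \<subseteq> {1..length ys} \<and> rename_monom ys n = m. mps_coeff (ser (k - card Z) c) n)"
    unfolding hat_def ys_def [symmetric] eval_at_vars_def by (simp add: Abs_mps_inverse)
  also have "\<dots> = (if Poly_Mapping.keys m \<subseteq> set ys then c ?l else 0)"
    using comp_monom_eq_iff [of ?l "comp_monom ?l"] unfolding S by (simp add: coeff_ser len)
  finally show "mps_coeff (hat k (Suc ` Z) (ser (k - card Z) c)) m =
      mps_coeff (ser k (\<lambda>l. if \<forall>i\<in>Z. l ! i = 0 then c (nths l (- Z)) else 0)) m"
    unfolding coeff_ser keys l by simp
qed

section \<open>Deleting parts equal to 0\<close>

lemma cuts_Cons: "cuts (x # l) = insert 0 ((+) x ` cuts l)"
proof -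
  have "p \<in> cuts (x # l) \<longleftrightarrow> p = 0 \<or> (\<exists>i. p = x + psum l i)" for p
    unfolding cuts_def image_iff by (metis UNIV_I not0_implies_Suc psum_0 psum_Cons)
  then show ?thesis by (auto simp: cuts_def)
qed

lemma zero_in_cuts: "0 \<in> cuts l"
  unfolding cuts_def by (metis psum_0 rangeI)

lemma cuts_nths:
  "\<forall>i<length l. i \<notin> A \<longrightarrow> l ! i = 0 \<Longrightarrow> cuts (nths l A) = cuts l \<and> sum_list (nths l A) = sum_list l"
proof (induction l arbitrary: A)
  case (Cons x l)
  have "\<forall>i<length l. i \<notin> {j. Suc j \<in> A} \<longrightarrow> l ! i = 0" using Cons.prems by auto
  note IH = Cons.IH [OF this]
  have "x = 0" if "0 \<notin> A" using Cons.prems that by auto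
  then show ?case using IH zero_in_cuts [of l] by (auto simp: nths_Cons cuts_Cons)
qed simp

lemma nths_Compl_single: "nths l (- {i}) = take i l @ drop (Suc i) l"
proof (induction l arbitrary: i)
  case (Cons x l)
  have "{j. Suc j \<in> - {0}} = (UNIV :: nat set)" "{j. Suc j \<in> - {Suc n}} = - {n}" for n by auto
  then show ?case using Cons by (cases i) (auto simp: nths_Cons nths_all)
qed simp


definition VFcard :: "nat list \<Rightarrow> nat" where
  "VFcard l = card (VF (sum_list l) (cuts l))"

lemma VFcard_nths: "\<forall>i\<in>Z. l ! i = 0 \<Longrightarrow> VFcard (nths l (- Z)) = VFcard l"
  using cuts_nths [of l "- Z"] by (simp add: VFcard_def)

text \<open>Different sets of positions exclude each other, so the terms of a recurrence are told
  apart by where the zeros are; \<open>Z = {}\<close> is the pattern of the series without a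
  hat.\<close>

definition zero_pattern :: "nat set \<Rightarrow> nat list \<Rightarrow> bool" where
  "zero_pattern Z l \<longleftrightarrow> (\<forall>i<length l. l ! i = 0 \<longleftrightarrow> i \<in> Z)"

lemma zero_pattern_nths:
  assumes "Z \<subseteq> {..<length l}"
  shows "(\<forall>i\<in>Z. l ! i = 0) \<and> (\<forall>p\<in>set (nths l (- Z)). 0 < p) \<longleftrightarrow> zero_pattern Z l"
  using assms unfolding zero_pattern_def set_nths by auto

lemma zero_pattern_empty: "zero_pattern {} l \<longleftrightarrow> (\<forall>p\<in>set l. 0 < p)"
  by (auto simp: zero_pattern_def all_set_conv_all_nth)

lemma L_eq: "L k = ser k (\<lambda>l. if zero_pattern {} l then int (VFcard l) else 0)"
  unfolding L_def comp_series_eq_ser zero_pattern_empty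
  by (intro ser_cong if_cong refl) (simp only: VFcard_def unimodal_invs_eq)

lemma LJ_eq: "LJ k j = ser k (\<lambda>l. if zero_pattern {} l then int (ecard AS j l) else 0)"
  unfolding LJ_def comp_series_eq_ser zero_pattern_empty
  by (intro ser_cong if_cong refl) (simp only: ecard_def unimodal_invs_j_eq)

lemma D_eq: "1 \<le> k \<Longrightarrow> D k j = ser k (\<lambda>l. if zero_pattern {} l then int (ecard DS j l) else 0)"
  unfolding D_def comp_series_eq_ser zero_pattern_empty
  by (intro ser_cong if_cong refl) (subst decr_invs_eq, auto simp: ecard_def)

lemma hat_ser_pattern:
  assumes Z: "Z \<subseteq> {..<k}"
    and eq: "\<And>l. length l = k \<Longrightarrow> zero_pattern Z l \<Longrightarrow> c (nths l (- Z)) = d l"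
  shows "hat k (Suc ` Z) (ser (k - card Z) (\<lambda>l. if zero_pattern {} l then int (c l) else 0)) =
    ser k (\<lambda>l. if zero_pattern Z l then int (d l) else 0)"
  unfolding hat_ser [OF Z] zero_pattern_empty
proof (rule ser_cong)
  fix l :: "nat list" assume l: "length l = k"
  then have "(\<forall>i\<in>Z. l ! i = 0) \<and> (\<forall>p\<in>set (nths l (- Z)). 0 < p) \<longleftrightarrow> zero_pattern Z l"
    using Z zero_pattern_nths by blast
  then show "(if \<forall>i\<in>Z. l ! i = 0 then if \<forall>p\<in>set (nths l (- Z)). 0 < p then int (c (nths l (- Z))) else 0 else 0) =
    (if zero_pattern Z l then int (d l) else 0)"
    using eq [OF l] by auto
qed

lemma hat_L:
  assumes Z: "Z \<subseteq> {..<k}"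
  shows "hat k (Suc ` Z) (L (k - card Z)) = ser k (\<lambda>l. if zero_pattern Z l then int (VFcard l) else 0)"
  unfolding L_eq
proof (rule hat_ser_pattern [OF Z])
  fix l :: "nat list" assume "length l = k" "zero_pattern Z l"
  then show "VFcard (nths l (- Z)) = VFcard l"
    using Z by (intro VFcard_nths) (auto simp: zero_pattern_def)
qed

text \<open>At a part 0 the partial sums of index \<open>i\<close> and \<open>Suc i\<close>
  coincide. \<open>Suc i\<close> is chosen to match the first summand of \<open>block_sum\<close>,
  the only one left if that part was 1 before the removal.\<close>

lemma hat_E:
  assumes i: "1 \<le> i" "i < k"
  shows "hat k {Suc i} (ser (k - 1) (\<lambda>l. if zero_pattern {} l then int (ecard E i l) else 0)) =
    ser k (\<lambda>l. if zero_pattern {i} l then int (ecard E (Suc i) l) else 0)"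
proof -
  have "ecard E i (nths l (- {i})) = ecard E (Suc i) l" if l: "length l = k" "zero_pattern {i} l" for l
  proof -
    have li: "l ! i = 0" using l i by (auto simp: zero_pattern_def)
    have "\<forall>j<length l. j \<notin> - {i} \<longrightarrow> l ! j = 0" using li by simp
    note c = cuts_nths [OF this]
    have "psum (nths l (- {i})) i = psum l i"
      using i l by (simp add: nths_Compl_single psum_def)
    moreover have "psum l (Suc i) = psum l i" using i l li by (simp add: psum_Suc)
    moreover have "nths l (- {i}) ! 0 = l ! 0"
      using i l by (simp add: nths_Compl_single nth_append)
    ultimately show ?thesis using c by (simp add: ecard_def)
  qed
  then show ?thesis using hat_ser_pattern [of "{i}" k "ecard E i" "ecard E (Suc i)"] i by simp
qed

section \<open>The series of a single segment\<close>

lemma zero_pattern_dec: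
  "i < length l \<Longrightarrow> 0 < l ! i \<Longrightarrow> zero_pattern Z (dec i l) \<longleftrightarrow>
    (\<forall>j<length l. j \<noteq> i \<longrightarrow> (l ! j = 0 \<longleftrightarrow> j \<in> Z)) \<and> (l ! i = 1 \<longleftrightarrow> i \<in> Z)"
  by (auto simp: zero_pattern_def nth_dec)

lemma XX_ser:
  assumes "i < k"
  shows "X 1 * X (Suc i) * ser k c =
    ser k (\<lambda>l. if 0 < l ! 0 \<and> 0 < dec 0 l ! i then c (dec i (dec 0 l)) else 0)"
proof -
  have "X 1 * (X (Suc i) * ser k c) = ser k (\<lambda>l. if 0 < l ! 0 then if 0 < dec 0 l ! i then c (dec i (dec 0 l)) else 0 else 0)"
    using assms X_times_ser [of 0 k] by (simp add: X_times_ser)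
  also have "\<dots> = ser k (\<lambda>l. if 0 < l ! 0 \<and> 0 < dec 0 l ! i then c (dec i (dec 0 l)) else 0)"
    by (rule ser_cong) simp
  finally show ?thesis by (simp add: mult.assoc)
qed

lemma ecard_zero:
  assumes "\<And>s n P. E 0 s n P = VF n P" "l ! 0 = 0"
  shows "ecard E j l = VFcard l"
  using assms by (simp add: ecard_def VFcard_def)

text \<open>
  Removing the cycle \<open>(1 m)\<close> with \<open>m\<close> in segment \<open>i + 1\<close> may leave the first segment, that segment, or
  both of them empty; the hatted series account for these cases.
\<close>

lemma block_series:
  assumes E: "\<And>s n P. E 0 s n P = VF n P" and i: "1 \<le> i" "i < k"
  defines "G \<equiv> \<lambda>k j. ser k (\<lambda>l. if zero_pattern {} l then int (ecard E j l) else 0)"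
  shows "X 1 * X (Suc i) * (2 * hat k {1} (L (k - 1)) + hat k {Suc i} (G (k - 1) i) + hat k {1, Suc i} (L (k - 2)) +
      G k (Suc i) + G k i) =
    ser k (\<lambda>l. if zero_pattern {} l then int (block_sum E l i) else 0)"
proof -
  have h1: "hat k {1} (L (k - 1)) = ser k (\<lambda>l. if zero_pattern {0} l then int (VFcard l) else 0)"
    using hat_L [of "{0}" k] i by simp
  have h2: "hat k {1, Suc i} (L (k - 2)) = ser k (\<lambda>l. if zero_pattern {0, i} l then int (VFcard l) else 0)"
    using hat_L [of "{0, i}" k] i by (simp add: numeral_2_eq_2)
  have hi: "hat k {Suc i} (G (k - 1) i) = ser k (\<lambda>l. if zero_pattern {i} l then int (ecard E (Suc i) l) else 0)"
    unfolding G_def using hat_E [OF i] by simp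
  show ?thesis
    unfolding mult_2 h1 h2 hi unfolding G_def ser_add XX_ser [OF i(2)]
  proof (rule ser_cong)
    fix l :: "nat list" assume l: "length l = k"
    define l' where "l' = dec i (dec 0 l)"
    have l': "length l' = k" "l' ! 0 = l ! 0 - 1" "l' ! i = l ! i - 1" "\<And>j. j < k \<Longrightarrow> j \<noteq> 0 \<Longrightarrow> j \<noteq> i \<Longrightarrow> l' ! j = l ! j"
      "dec 0 l ! i = l ! i"
      using i l by (auto simp: l'_def nth_dec)
    let ?rest = "\<forall>j<k. j \<noteq> 0 \<and> j \<noteq> i \<longrightarrow> 0 < l ! j"
    have split: "(\<forall>j<k. Q j) \<longleftrightarrow> Q 0 \<and> Q i \<and> (\<forall>j<k. j \<noteq> 0 \<and> j \<noteq> i \<longrightarrow> Q j)" for Q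
    proof -
      have "Q j" if "Q 0" "Q i" "\<forall>j<k. j \<noteq> 0 \<and> j \<noteq> i \<longrightarrow> Q j" "j < k" for j
        using that by (cases "j = 0"; cases "j = i") simp_all
      moreover have "0 < k" using i by simp
      ultimately show ?thesis using i(2) by (intro iffI conjI) simp_all
    qed
    have zp: "zero_pattern Z l' \<longleftrightarrow> (l' ! 0 = 0 \<longleftrightarrow> 0 \<in> Z) \<and> (l' ! i = 0 \<longleftrightarrow> i \<in> Z) \<and> ?rest" if "Z \<subseteq> {0, i}" for Z
    proof -
      have "(l' ! j = 0 \<longleftrightarrow> j \<in> Z) \<longleftrightarrow> 0 < l ! j" if "j < k" "j \<noteq> 0" "j \<noteq> i" for j
        using l'(4) [OF that] that \<open>Z \<subseteq> {0, i}\<close> by auto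
      then have "(\<forall>j<k. j \<noteq> 0 \<and> j \<noteq> i \<longrightarrow> (l' ! j = 0 \<longleftrightarrow> j \<in> Z)) \<longleftrightarrow> ?rest" by blast
      then show ?thesis
        unfolding zero_pattern_def l'(1) split [of "\<lambda>j. l' ! j = 0 \<longleftrightarrow> j \<in> Z"] by (simp only:)
    qed
    have zl: "zero_pattern {} l \<longleftrightarrow> 0 < l ! 0 \<and> 0 < l ! i \<and> ?rest"
      unfolding zero_pattern_def l split [of "\<lambda>j. l ! j = 0 \<longleftrightarrow> j \<in> {}"] by auto
    have ez: "int (ecard E j l') = int (VFcard l')" if "l' ! 0 = 0" for j
      using ecard_zero [of E l' j] E that by simp
    have "i \<noteq> 0" using i by simp
    \<comment> \<open>If both parts exceed 1, both summands of \<open>block_sum\<close> occur. If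
      only the first part is 1, they agree and give the factor 2. If part \<open>i\<close> is 1, its
      segment contributes once, to the series with one or two deleted variables according to whether
      the first part exceeds 1.\<close>
    show "(if 0 < l ! 0 \<and> 0 < dec 0 l ! i
      then (if zero_pattern {0} (dec i (dec 0 l)) then int (VFcard (dec i (dec 0 l))) else 0) +
        (if zero_pattern {0} (dec i (dec 0 l)) then int (VFcard (dec i (dec 0 l))) else 0) +
        (if zero_pattern {i} (dec i (dec 0 l)) then int (ecard E (Suc i) (dec i (dec 0 l))) else 0) +
        (if zero_pattern {0, i} (dec i (dec 0 l)) then int (VFcard (dec i (dec 0 l))) else 0) +
        (if zero_pattern {} (dec i (dec 0 l)) then int (ecard E (Suc i) (dec i (dec 0 l))) else 0) +
        (if zero_pattern {} (dec i (dec 0 l)) then int (ecard E i (dec i (dec 0 l))) else 0)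
      else 0) = (if zero_pattern {} l then int (block_sum E l i) else 0)"
      unfolding block_sum_def l'_def [symmetric] l'(5) zl
      using \<open>i \<noteq> 0\<close> l'(2,3)
      by (cases "l ! 0 = 1"; cases "l ! i = 1") (auto simp: zp ez)
  qed
qed

text \<open>The hatted terms collect the compositions whose first part is used up: a part 1 that
  loses a fixed point, or a part 2 that loses the cycle of its ends. In the third identity the count
  does not depend on the first part, so multiplying by \<open>X 1\<close> loses only first part 1,
  which the hatted term restores.\<close>

lemma first_block_series:
  assumes k: "1 \<le> k"
  shows "X 1 * (hat k {1} (L (k - 1)) + L k) =
      ser k (\<lambda>l. if zero_pattern {} l then int (VFcard (dec 0 l)) else 0)"
    and "(X 1)\<^sup>2 * (hat k {1} (L (k - 1)) + LJ k 1) =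
      ser k (\<lambda>l. if zero_pattern {} l then int (if 2 \<le> l ! 0 then ecard AS 1 (dec 0 (dec 0 l)) else 0) else 0)"
    and "X 1 * (hat k {1} (L (k - 1)) + D k 1) = D k 1"
proof -
  have h1: "hat k {1} (L (k - 1)) = ser k (\<lambda>l. if zero_pattern {0} l then int (VFcard l) else 0)"
    using hat_L [of "{0}" k] k by simp
  have k0: "0 < k" using k by simp
  have X1: "X 1 = X (Suc 0)" by simp
  have zl: "zero_pattern {} l \<longleftrightarrow> 0 < l ! 0 \<and> (\<forall>j<k. j \<noteq> 0 \<longrightarrow> 0 < l ! j)" if "length l = k" for l
    using that k0 by (auto simp: zero_pattern_def)
  have zd: "zero_pattern {} (dec 0 l) \<longleftrightarrow> 2 \<le> l ! 0 \<and> zero_pattern {} l"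
    "zero_pattern {0} (dec 0 l) \<longleftrightarrow> l ! 0 = 1 \<and> zero_pattern {} l" if "length l = k" "0 < l ! 0" for l
    using that k0 zl by (auto simp: zero_pattern_dec)
  have zz: "0 < l ! 0" if "length l = k" "zero_pattern {} l" for l
    using zl that by simp
  show "X 1 * (hat k {1} (L (k - 1)) + L k) =
      ser k (\<lambda>l. if zero_pattern {} l then int (VFcard (dec 0 l)) else 0)"
    unfolding h1 unfolding L_eq ser_add X1 X_times_ser [OF k0]
  proof (rule ser_cong)
    fix l :: "nat list" assume l: "length l = k"
    show "(if 0 < l ! 0
      then (if zero_pattern {0} (dec 0 l) then int (VFcard (dec 0 l)) else 0) +
        (if zero_pattern {} (dec 0 l) then int (VFcard (dec 0 l)) else 0)
      else 0) = (if zero_pattern {} l then int (VFcard (dec 0 l)) else 0)"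
      using zd [OF l] zz [OF l] by auto
  qed
  have X2: "(X 1)\<^sup>2 = X 1 * X (Suc 0)" by (simp add: power2_eq_square)
  have d0: "dec 0 l ! 0 = l ! 0 - 1" if "length l = k" for l using that k0 by (simp add: nth_dec)
  show "(X 1)\<^sup>2 * (hat k {1} (L (k - 1)) + LJ k 1) =
      ser k (\<lambda>l. if zero_pattern {} l then int (if 2 \<le> l ! 0 then ecard AS 1 (dec 0 (dec 0 l)) else 0) else 0)"
    unfolding h1 unfolding LJ_eq ser_add X2 XX_ser [OF k0]
  proof (rule ser_cong)
    fix l :: "nat list" assume l: "length l = k"
    show "(if 0 < l ! 0 \<and> 0 < dec 0 l ! 0
      then (if zero_pattern {0} (dec 0 (dec 0 l)) then int (VFcard (dec 0 (dec 0 l))) else 0) +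
        (if zero_pattern {} (dec 0 (dec 0 l)) then int (ecard AS 1 (dec 0 (dec 0 l))) else 0)
      else 0) =
      (if zero_pattern {} l then int (if 2 \<le> l ! 0 then ecard AS 1 (dec 0 (dec 0 l)) else 0) else 0)"
    proof (cases "2 \<le> l ! 0")
      case True
      then have d: "length (dec 0 l) = k" "0 < dec 0 l ! 0" "0 < l ! 0" using l d0 by auto
      have "zero_pattern {0} (dec 0 (dec 0 l)) \<longleftrightarrow> l ! 0 = 2 \<and> zero_pattern {} l"
        "zero_pattern {} (dec 0 (dec 0 l)) \<longleftrightarrow> 3 \<le> l ! 0 \<and> zero_pattern {} l"
        unfolding zd [OF d(1,2)] zd [OF l d(3)] using d0 [OF l] True by auto
      moreover have "ecard AS 1 (dec 0 (dec 0 l)) = VFcard (dec 0 (dec 0 l))" if "l ! 0 = 2"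
        using that d0 l k0 by (intro ecard_zero) (auto simp: AS_0 nth_dec)
      ultimately show ?thesis using True d by auto
    next
      case False
      then show ?thesis using d0 [OF l] by auto
    qed
  qed
  have D1: "D k 1 = ser k (\<lambda>l. if zero_pattern {} l then int (VFcard (tl l)) else 0)"
    unfolding D_eq [OF k]
  proof (rule ser_cong)
    fix l :: "nat list" assume l: "length l = k"
    then obtain t l' where "l = t # l'" using k0 by (cases l) auto
    then show "(if zero_pattern {} l then int (ecard DS 1 l) else 0) = (if zero_pattern {} l then int (VFcard (tl l)) else 0)"
      using card_DS_first [of t l'] by (simp add: VFcard_def)
  qed
  show "X 1 * (hat k {1} (L (k - 1)) + D k 1) = D k 1"
    unfolding h1 D1 ser_add X1 X_times_ser [OF k0]
  proof (rule ser_cong)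
    fix l :: "nat list" assume l: "length l = k"
    then obtain t l' where tl: "l = t # l'" using k0 by (cases l) auto
    have "VFcard (dec 0 l) = VFcard (tl l)" if "l ! 0 = 1"
      using that tl by (simp add: VFcard_def dec_def cuts_Cons_0)
    moreover have "tl (dec 0 l) = tl l" using tl by (simp add: dec_def)
    ultimately show "(if 0 < l ! 0
      then (if zero_pattern {0} (dec 0 l) then int (VFcard (dec 0 l)) else 0) +
        (if zero_pattern {} (dec 0 l) then int (VFcard (tl (dec 0 l))) else 0)
      else 0) = (if zero_pattern {} l then int (VFcard (tl l)) else 0)"
      using zd [OF l] zz [OF l] by auto
  qed
qed

section \<open>The equations before they are solved for the unknown series\<close>

lemma zero_pattern_pos:
  assumes "zero_pattern {} l" "length l = k" "1 \<le> k"
  shows "l \<noteq> []" "\<forall>p\<in>set l. 0 < p"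
  using assms by (auto simp: zero_pattern_empty)

text \<open>The summands belong to \<pi> 1 = 1, to \<pi> 1 at the end of the first segment, and to
  the later segments. The unknown recurs on the right because removing a fixed point leaves an
  arbitrary unimodal involution.\<close>

lemma L_sum:
  assumes k: "1 \<le> k"
  shows "L k = X 1 * (hat k {1} (L (k - 1)) + L k) + (X 1)\<^sup>2 * (hat k {1} (L (k - 1)) + LJ k 1) +
    (\<Sum>i=1..<k. ser k (\<lambda>l. if zero_pattern {} l then int (block_sum AS l i) else 0))"
  unfolding first_block_series(1,2) [OF k] ser_sum [OF finite_atLeastLessThan] ser_add
proof (subst L_eq, rule ser_cong)
  fix l :: "nat list" assume l: "length l = k"
  show "(if zero_pattern {} l then int (VFcard l) else 0) =
    (if zero_pattern {} l then int (VFcard (dec 0 l)) else 0) +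
    (if zero_pattern {} l then int (if 2 \<le> l ! 0 then ecard AS 1 (dec 0 (dec 0 l)) else 0) else 0) +
    (\<Sum>i=1..<k. if zero_pattern {} l then int (block_sum AS l i) else 0)"
  proof (cases "zero_pattern {} l")
    case True
    note p = zero_pattern_pos [OF True l k]
    show ?thesis
      using True l card_unimodal_invs [OF p] by (simp add: VFcard_def unimodal_invs_eq [OF p(2)])
  qed simp
qed

lemma LJ_sum:
  assumes j: "1 \<le> j" "j \<le> k"
  shows "LJ k j = D k j + (\<Sum>i=j..<k. ser k (\<lambda>l. if zero_pattern {} l then int (block_sum AS l i) else 0))"
proof -
  have k: "1 \<le> k" using j by simp
  show ?thesis
    unfolding LJ_eq D_eq [OF k] ser_sum [OF finite_atLeastLessThan] ser_add
  proof (rule ser_cong)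
    fix l :: "nat list" assume l: "length l = k"
    show "(if zero_pattern {} l then int (ecard AS j l) else 0) =
      (if zero_pattern {} l then int (ecard DS j l) else 0) +
      (\<Sum>i=j..<k. if zero_pattern {} l then int (block_sum AS l i) else 0)"
    proof (cases "zero_pattern {} l")
      case True
      note p = zero_pattern_pos [OF True l k]
      show ?thesis
        using True l j card_unimodal_invs_j [OF p, of j] unimodal_invs_j_eq [OF p(2)] decr_invs_eq [OF p(2,1)]
        by (simp add: ecard_def)
    qed simp
  qed
qed

lemma D_sum:
  assumes i: "1 \<le> i" "i < k"
  shows "D k (Suc i) = D k i + ser k (\<lambda>l. if zero_pattern {} l then int (block_sum DS l i) else 0)"
proof -
  have k: "1 \<le> k" using i by simp
  show ?thesis
    unfolding D_eq [OF k] ser_add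
  proof (rule ser_cong)
    fix l :: "nat list" assume l: "length l = k"
    show "(if zero_pattern {} l then int (ecard DS (Suc i) l) else 0) =
      (if zero_pattern {} l then int (ecard DS i l) else 0) +
      (if zero_pattern {} l then int (block_sum DS l i) else 0)"
    proof (cases "zero_pattern {} l")
      case True
      note p = zero_pattern_pos [OF True l k]
      show ?thesis
        using True l i card_decr_invs_Suc [OF p, of i] decr_invs_eq [OF p(2,1)]
        by (simp add: ecard_def)
    qed simp
  qed
qed

section \<open>Small numbers of parts, and division by units\<close>

lemma VF_0: "VF 0 P = {id}"
  by (auto simp: VF_def involutions_def valley_free_def)

lemma L_0: "L 0 = 1"
proof (rule mps_eqI)
  fix m
  have "vec 0 m = []" "zero_pattern {} []" "VFcard [] = 1" for m
    by (simp_all add: zero_pattern_def VFcard_def VF_0 vec_def)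
  then show "mps_coeff (L 0) m = mps_coeff 1 m"
    by (simp add: L_eq coeff_ser one_mps.rep_eq)
qed

lemma hat_1_1: "hat 1 {1} (1 :: int mps) = 1"
proof (rule mps_eqI)
  fix m :: "nat \<Rightarrow>\<^sub>0 nat"
  have h1: "hat 1 {1} (L 0) = ser 1 (\<lambda>l. if zero_pattern {0} l then int (VFcard l) else 0)"
    using hat_L [of "{0}" 1] by simp
  have v: "vec 1 m = [Poly_Mapping.lookup m 1]" by (simp add: vec_def)
  have "VFcard [0] = 1" by (simp add: VFcard_def VF_0)
  moreover have "Poly_Mapping.keys m \<subseteq> {1..1} \<and> Poly_Mapping.lookup m 1 = 0 \<longleftrightarrow> m = 0"
    by (auto simp: subset_iff in_keys_iff poly_mapping_eq_iff fun_eq_iff)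
  ultimately show "mps_coeff (hat 1 {1} (1 :: int mps)) m = mps_coeff 1 m"
    unfolding L_0 [symmetric] h1 coeff_ser v
    by (auto simp: zero_pattern_def L_0 one_mps.rep_eq)
qed

text \<open>For equations whose unknown has been collected on the left. The first hypothesis says
  that \<open>a\<close> is a unit; otherwise \<open>inverse a\<close> would be 0 by
  convention.\<close>

lemma eq_divideI:
  fixes a f g :: "int mps"
  assumes "a * inverse a = 1" "a * f = g"
  shows "f = 1 / a * g"
proof -
  have "1 / a * g = (a * inverse a) * f"
    unfolding divide_mps_def assms(2) [symmetric] by (simp add: algebra_simps)
  then show ?thesis using assms(1) by simp
qed

lemma D_1:
  assumes "1 \<le> k"
  shows "D k 1 = X 1 / (1 - X 1) * hat k {1} (L (k - 1))"
proof -
  have "(1 - X 1) * D k 1 = X 1 * hat k {1} (L (k - 1))"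
    using first_block_series(3) [OF assms] by (simp add: algebra_simps)
  from eq_divideI [OF one_minus_X_inverse this]
  show ?thesis by (simp add: divide_mps_def algebra_simps)
qed

lemma L_1: "L 1 = X 1 / (1 - X 1)\<^sup>2"
proof -
  let ?a = "1 - X 1 :: int mps"
  have h: "hat 1 {1} (L 0) = 1" using hat_1_1 by (simp add: L_0)
  have inv: "?a * inverse ?a = 1" by (rule one_minus_X_inverse)
  \<comment> \<open>With one part there are no later segments. \<open>D 1 1\<close> is a geometric
    series, so the equation for \<open>L 1\<close> contains no other unknown.\<close>
  have "LJ 1 1 = D 1 1" using LJ_sum [of 1 1] by simp
  then have l: "?a * LJ 1 1 = X 1"
    using first_block_series(3) [of 1] h by (simp add: algebra_simps)
  have "L 1 = X 1 * (1 + L 1) + (X 1)\<^sup>2 * (1 + LJ 1 1)"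
    using L_sum [of 1] h by simp
  then have "?a * L 1 = X 1 + (X 1)\<^sup>2 * (1 + LJ 1 1)"
    by (simp add: algebra_simps)
  then have "?a\<^sup>2 * L 1 = ?a * (X 1 + (X 1)\<^sup>2 * (1 + LJ 1 1))"
    by (simp only: power2_eq_square mult.assoc)
  also have "\<dots> = ?a * X 1 + (X 1)\<^sup>2 * (?a + ?a * LJ 1 1)"
  proof -
    \<comment> \<open>Stated for arbitrary ring elements, so that \<open>1 - X 1\<close> is not
      multiplied out before \<open>l\<close> is applied.\<close>
    have "a * (x + y * (1 + z)) = a * x + y * (a + a * z)" for a x y z :: "int mps"
      by (simp add: algebra_simps)
    then show ?thesis .
  qed
  also have "\<dots> = X 1" unfolding l by (simp add: power2_eq_square algebra_simps)
  finally have "?a\<^sup>2 * L 1 = X 1" .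
  moreover have "?a\<^sup>2 * (inverse ?a)\<^sup>2 = 1" using inv by (simp flip: power_mult_distrib)
  then have "?a\<^sup>2 * inverse (?a\<^sup>2) = 1" using mps_inverse_unique by metis
  ultimately have "L 1 = 1 / ?a\<^sup>2 * X 1" by (intro eq_divideI)
  then show ?thesis by (simp add: divide_mps_def mult.commute)
qed


theorem theorem4p1:
  shows
   "L 0 = 1 \<and>
    L 1 = X 1 / (1 - X 1)\<^sup>2 \<and>
    (\<forall>k\<ge>2. L k = 1 / (1 - X 1) *
       ((X 1)\<^sup>2 * LJ k 1 + (X 1 + (X 1)\<^sup>2) * hat k {1} (L (k - 1))
        + (\<Sum>i=2..k. X 1 * X i *
             (2 * hat k {1} (L (k - 1)) + hat k {i} (LJ (k - 1) (i - 1))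
              + hat k {1, i} (L (k - 2)) + LJ k i + LJ k (i - 1))))) \<and>
    (\<forall>k\<ge>1. LJ k k = D k k) \<and>
    (\<forall>k j. 1 \<le> j \<and> j < k \<longrightarrow> LJ k j = 1 / (1 - X 1 * X (j + 1)) *
       (D k j + (\<Sum>i=j+2..k. X 1 * X i * LJ k (i - 1))
        + (\<Sum>i=j+1..k. X 1 * X i *
             (2 * hat k {1} (L (k - 1)) + hat k {i} (LJ (k - 1) (i - 1))
              + hat k {1, i} (L (k - 2)) + LJ k i)))) \<and>
    (\<forall>k\<ge>1. D k 1 = X 1 / (1 - X 1) * hat k {1} (L (k - 1))) \<and>
    (\<forall>k i. 2 \<le> i \<and> i \<le> k \<longrightarrow> D k i = 1 / (1 - X 1 * X i) *
       (D k (i - 1) + X 1 * X i *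
          (D k (i - 1) + hat k {i} (D (k - 1) (i - 1))
           + hat k {1, i} (L (k - 2)) + 2 * hat k {1} (L (k - 1)))))"
proof (intro conjI allI impI)
  \<comment> \<open>Segments are numbered from 0 and variables from 1, hence the shift of the
    index.\<close>
  have LJ_blocks: "(\<Sum>i=j..<k. ser k (\<lambda>l. if zero_pattern {} l then int (block_sum AS l i) else 0)) =
    (\<Sum>i=Suc j..k. X 1 * X i *
       (2 * hat k {1} (L (k - 1)) + hat k {i} (LJ (k - 1) (i - 1)) + hat k {1, i} (L (k - 2)) + LJ k i + LJ k (i - 1)))"
    if j: "1 \<le> j" for k j
  proof -
    have "(\<Sum>i=Suc j..<Suc k. X 1 * X i *
       (2 * hat k {1} (L (k - 1)) + hat k {i} (LJ (k - 1) (i - 1)) + hat k {1, i} (L (k - 2)) + LJ k i + LJ k (i - 1))) =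
      (\<Sum>i=j..<k. X 1 * X (Suc i) *
       (2 * hat k {1} (L (k - 1)) + hat k {Suc i} (LJ (k - 1) i) + hat k {1, Suc i} (L (k - 2)) + LJ k (Suc i) + LJ k i))"
      unfolding sum.shift_bounds_Suc_ivl by simp
    also have "\<dots> = (\<Sum>i=j..<k. ser k (\<lambda>l. if zero_pattern {} l then int (block_sum AS l i) else 0))"
    proof (intro sum.cong refl)
      fix i assume "i \<in> {j..<k}"
      then have "1 \<le> i" "i < k" using j by auto
      from block_series [of AS, OF AS_0 this, folded LJ_eq]
      show "X 1 * X (Suc i) * (2 * hat k {1} (L (k - 1)) + hat k {Suc i} (LJ (k - 1) i) + hat k {1, Suc i} (L (k - 2)) +
          LJ k (Suc i) + LJ k i) = ser k (\<lambda>l. if zero_pattern {} l then int (block_sum AS l i) else 0)" .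
    qed
    finally show ?thesis by (simp only: atLeastLessThanSuc_atLeastAtMost)
  qed
  show "L 0 = 1" by (rule L_0)
  show "L 1 = X 1 / (1 - X 1)\<^sup>2" by (rule L_1)
  show "L k = 1 / (1 - X 1) *
       ((X 1)\<^sup>2 * LJ k 1 + (X 1 + (X 1)\<^sup>2) * hat k {1} (L (k - 1))
        + (\<Sum>i=2..k. X 1 * X i *
             (2 * hat k {1} (L (k - 1)) + hat k {i} (LJ (k - 1) (i - 1))
              + hat k {1, i} (L (k - 2)) + LJ k i + LJ k (i - 1))))" (is "_ = _ * (?a + ?b + ?s)") if "2 \<le> k" for k
  proof (rule eq_divideI [OF one_minus_X_inverse])
    have "L k = X 1 * (hat k {1} (L (k - 1)) + L k) + (X 1)\<^sup>2 * (hat k {1} (L (k - 1)) + LJ k 1) + ?s"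
      using L_sum [of k] LJ_blocks [of 1 k] that by (simp add: numeral_2_eq_2)
    then show "(1 - X 1) * L k = ?a + ?b + ?s" by (simp add: algebra_simps)
  qed
  show "LJ k k = D k k" if "1 \<le> k" for k
    using LJ_sum [of k k] that by simp
  show "LJ k j = 1 / (1 - X 1 * X (j + 1)) *
       (D k j + (\<Sum>i=j+2..k. X 1 * X i * LJ k (i - 1))
        + (\<Sum>i=j+1..k. X 1 * X i *
             (2 * hat k {1} (L (k - 1)) + hat k {i} (LJ (k - 1) (i - 1))
              + hat k {1, i} (L (k - 2)) + LJ k i)))" (is "_ = _ * (_ + ?s + ?t)") if "1 \<le> j \<and> j < k" for k j
  proof (rule eq_divideI [OF one_minus_XX_inverse])
    let ?f = "\<lambda>i. X 1 * X i * LJ k (i - 1)"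
    have "LJ k j = D k j + (?t + (\<Sum>i=Suc j..k. ?f i))"
      using LJ_sum [of j k] LJ_blocks [of j k] that by (simp add: sum.distrib distrib_left)
    \<comment> \<open>The term for \<open>j + 1\<close> contains \<open>LJ k j\<close> itself and
      yields the denominator; the remaining sum starts at \<open>j + 2\<close>.\<close>
    also have "(\<Sum>i=Suc j..k. ?f i) = X 1 * X (j + 1) * LJ k j + ?s"
      using that by (simp add: sum.atLeast_Suc_atMost)
    finally show "(1 - X 1 * X (j + 1)) * LJ k j = D k j + ?s + ?t"
      by (simp add: algebra_simps)
  qed
  show "D k 1 = X 1 / (1 - X 1) * hat k {1} (L (k - 1))" if "1 \<le> k" for k
    using that by (rule D_1)
  show "D k i = 1 / (1 - X 1 * X i) *
       (D k (i - 1) + X 1 * X i *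
          (D k (i - 1) + hat k {i} (D (k - 1) (i - 1))
           + hat k {1, i} (L (k - 2)) + 2 * hat k {1} (L (k - 1))))" if ik: "2 \<le> i \<and> i \<le> k" for k i
  proof (rule eq_divideI [OF one_minus_XX_inverse])
    obtain i' where i: "i = Suc i'" "1 \<le> i'" "i' < k" using ik by (cases i) auto
    then have k: "1 \<le> k" "1 \<le> k - 1" by auto
    have "X 1 * X (Suc i') * (2 * hat k {1} (L (k - 1)) + hat k {Suc i'} (D (k - 1) i') + hat k {1, Suc i'} (L (k - 2)) +
        D k (Suc i') + D k i') = ser k (\<lambda>l. if zero_pattern {} l then int (block_sum DS l i') else 0)"
      using block_series [of DS, OF DS_0 i(2,3)] unfolding D_eq [OF k(1)] D_eq [OF k(2)] .
    then have "D k i = D k i' + X 1 * X i * (2 * hat k {1} (L (k - 1)) + hat k {i} (D (k - 1) i') +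
        hat k {1, i} (L (k - 2)) + D k i + D k i')"
      using D_sum [OF i(2,3)] unfolding i(1) by (simp only:)
    \<comment> \<open>Only the product with \<open>D k i\<close> moves to the left;
      \<open>D k (i - 1)\<close> stays, once alone and once inside the bracket.\<close>
    then show "(1 - X 1 * X i) * D k i = D k (i - 1) + X 1 * X i *
          (D k (i - 1) + hat k {i} (D (k - 1) (i - 1))
           + hat k {1, i} (L (k - 2)) + 2 * hat k {1} (L (k - 1)))"
      using i(1) by (simp add: algebra_simps)
  qed
qed

end
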